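(* Let $n\in\mathbb{N}$ and let $\omega(z)=cz^n+p_{n-1}z^{n-1}+\cdots+p_0$ be a polynomial with $c\ne0$. If $f$ is a meromorphic function in $\mathbb{C}$ such that $$\limsup_{r\to\infty}\frac{\log\log T(r,f)}{\log r}<\frac{1}{n^2},$$ then $$T(r,f\circ\omega)=(1+o(1))\,T(|c|r^n,f)$$ as $r\to\infty$ outside of a possible exceptional set of finite logarithmic measure.
   Context: $T(r,f)$ is the Nevanlinna characteristic. A set $E\subset[1,\infty)$ has finite logarithmic measure if $\int_E\frac{dt}{t}<\infty$. *)

theory Defs
  imports "HOL-Analysis.Analysis"
begin

definition pole_of_order :: "(complex \<Rightarrow> complex) \<Rightarrow> complex \<Rightarrow> nat \<Rightarrow> bool" where
  "pole_of_order f p k \<longleftrightarrow> k > 0 \<and> (\<exists>g r. r > 0 \<and> g holomorphic_on ball p r \<and> g p \<noteq> 0 \<and>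
      (\<forall>z\<in>ball p r - {p}. f z = g z / (z - p) ^ k))"

definition is_pole_pt :: "(complex \<Rightarrow> complex) \<Rightarrow> complex \<Rightarrow> bool" where
  "is_pole_pt f p \<longleftrightarrow> (\<exists>k. pole_of_order f p k)"

definition pole_order :: "(complex \<Rightarrow> complex) \<Rightarrow> complex \<Rightarrow> nat" where
  "pole_order f p = (if is_pole_pt f p then (THE k. pole_of_order f p k) else 0)"

definition meromorphic_C :: "(complex \<Rightarrow> complex) \<Rightarrow> bool" where
  "meromorphic_C f \<longleftrightarrow> (\<exists>P. (\<forall>z. \<not> z islimpt P) \<and> f holomorphic_on (UNIV - P) \<and>
      (\<forall>p\<in>P. is_pole_pt f p))"

definition logplus :: "real \<Rightarrow> real" where
  "logplus x = (if x \<le> 1 then 0 else ln x)"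

definition pole_count :: "real \<Rightarrow> (complex \<Rightarrow> complex) \<Rightarrow> real" where
  "pole_count t f = real (\<Sum>p\<in>{p. cmod p \<le> t \<and> is_pole_pt f p}. pole_order f p)"

definition integrated_count :: "real \<Rightarrow> (complex \<Rightarrow> complex) \<Rightarrow> real" where
  "integrated_count r f =
     (\<integral>t\<in>{0<..r}. (pole_count t f - pole_count 0 f) / t \<partial>lborel) + pole_count 0 f * ln r"

definition proximity :: "real \<Rightarrow> (complex \<Rightarrow> complex) \<Rightarrow> real" where
  "proximity r f = (1 / (2 * pi)) *
     (\<integral>\<theta>\<in>{0..2*pi}. logplus (cmod (f (complex_of_real r * cis \<theta>))) \<partial>lborel)"

definition nev_T :: "real \<Rightarrow> (complex \<Rightarrow> complex) \<Rightarrow> real" where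
  "nev_T r f = proximity r f + integrated_count r f"

definition finite_log_measure :: "real set \<Rightarrow> bool" where
  "finite_log_measure E \<longleftrightarrow> E \<subseteq> {1..} \<and> E \<in> sets lborel \<and>
     (\<integral>\<^sup>+ t. indicator E t / ennreal t \<partial>lborel) < \<infinity>"

end

theory Submission
  imports Defs "HOL-Complex_Analysis.Complex_Analysis" "HOL-Real_Asymp.Real_Asymp"
    "HOL-Computational_Algebra.Fundamental_Theorem_Algebra"
begin

text \<open>Write \<open>f = G / H\<close> with entire \<open>G\<close>, \<open>H\<close> without common zeros and let
  \<open>U = ln (max \<bar>G\<bar> \<bar>H\<bar>)\<close>, a continuous subharmonic function. By Jensen's formula for \<open>H\<close>, \<open>T(r, f)\<close> is
  the mean of \<open>U\<close> over the circle of radius \<open>r\<close> up to a constant, and \<open>T(r, f \<circ> \<omega>)\<close> is likewise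
  the mean of \<open>U \<circ> \<omega>\<close>.

  If \<open>\<omega>\<close> maps the disc of radius \<open>r\<close> into the disc of radius \<open>R\<close>, then the mean of \<open>U \<circ> \<omega>\<close> is at most
  \<open>P\<^sub>R U (\<omega> 0)\<close>, where \<open>P\<^sub>R\<close> is the Poisson integral, and conversely, if the disc of radius \<open>R\<close> has
  its preimage inside the disc of radius \<open>r\<close>, the mean of \<open>U\<close> over the circle of radius \<open>R\<close> is at most
  the average of \<open>P\<^sub>r (U \<circ> \<omega>)\<close> over the zeros of \<open>\<omega>\<close>. By Harnack's inequality, Poisson integrals at
  fixed points are at most \<open>1 + o(1)\<close> times the value at the centre. As \<open>R = \<bar>c\<bar> (r \<plusminus> K)\<^sup>n\<close> is
  admissible, \<open>T(r, f \<circ> \<omega>)\<close> lies between \<open>(1 + o(1)) T(\<bar>c\<bar> (r - K)\<^sup>n, f)\<close> and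
  \<open>(1 + o(1)) T(\<bar>c\<bar> (r + K)\<^sup>n, f)\<close>. Finally \<open>T(\<bar>c\<bar> r\<^sup>n, f)\<close> has hyper-order less than one as a
  function of \<open>r\<close>, so a Borel-type argument shows that the shifts by \<open>K\<close> do not matter off a set of
  finite logarithmic measure.\<close>

section \<open>Circle means and Poisson integrals\<close>

definition cmean :: "(complex \<Rightarrow> 'a::banach) \<Rightarrow> real \<Rightarrow> 'a" where
  "cmean u r = (1 / (2 * pi)) *\<^sub>R integral {0..2*pi} (\<lambda>t. u (of_real r * cis t))"

lemma continuous_on_circle:
  assumes "continuous_on (sphere 0 r) u" "r \<ge> 0"
  shows "continuous_on S (\<lambda>t. u (of_real r * cis t))"
  by (rule continuous_on_compose2[OF assms(1)]) (use assms(2) in \<open>auto intro!: continuous_intros simp: norm_mult\<close>)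

lemma integrable_on_circle:
  fixes u :: "complex \<Rightarrow> 'a::banach"
  assumes "continuous_on (sphere 0 r) u" "r \<ge> 0"
  shows "(\<lambda>t. u (of_real r * cis t)) integrable_on {0..2*pi}"
  by (rule integrable_continuous_interval[OF continuous_on_circle[OF assms]])

lemma cmean_cong:
  assumes "\<And>w. norm w = r \<Longrightarrow> u w = v w" "r \<ge> 0"
  shows "cmean u r = cmean v r"
proof -
  have "u (of_real r * cis t) = v (of_real r * cis t)" for t
    using assms by (simp add: norm_mult)
  thus ?thesis by (simp add: cmean_def)
qed

lemma cmean_const [simp]: "cmean (\<lambda>_. c) r = c"
  by (simp add: cmean_def)

lemma cmean_add:
  assumes "continuous_on (sphere 0 r) u" "continuous_on (sphere 0 r) v" "r \<ge> 0"
  shows "cmean (\<lambda>w. u w + v w) r = cmean u r + cmean v r"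
  using assms by (simp add: cmean_def integral_add integrable_on_circle scaleR_add_right)

lemma cmean_diff:
  assumes "continuous_on (sphere 0 r) u" "continuous_on (sphere 0 r) v" "r \<ge> 0"
  shows "cmean (\<lambda>w. u w - v w) r = cmean u r - cmean v r"
  using assms by (simp add: cmean_def integral_diff integrable_on_circle scaleR_diff_right)

lemma cmean_cmult: "cmean (\<lambda>w. c * u w) r = c * (cmean u r :: real)"
  by (simp add: cmean_def)

lemma cmean_sum:
  assumes "finite I" "\<And>i. i \<in> I \<Longrightarrow> continuous_on (sphere 0 r) (u i)" "r \<ge> 0"
  shows "cmean (\<lambda>w. \<Sum>i\<in>I. u i w) r = (\<Sum>i\<in>I. cmean (u i) r)"
  using assms by (simp add: cmean_def integral_sum integrable_on_circle scaleR_sum_right)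

lemma cmean_mono:
  fixes u v :: "complex \<Rightarrow> real"
  assumes "continuous_on (sphere 0 r) u" "continuous_on (sphere 0 r) v" "r \<ge> 0"
    and "\<And>w. norm w = r \<Longrightarrow> u w \<le> v w"
  shows "cmean u r \<le> cmean v r"
proof -
  have "integral {0..2*pi} (\<lambda>t. u (of_real r * cis t)) \<le> integral {0..2*pi} (\<lambda>t. v (of_real r * cis t))"
    using assms by (intro integral_le integrable_on_circle) (auto simp: norm_mult)
  thus ?thesis by (simp add: cmean_def divide_right_mono)
qed

lemma Re_cmean:
  assumes "continuous_on (sphere 0 r) u" "r \<ge> 0"
  shows "cmean (\<lambda>w. Re (u w)) r = Re (cmean u r)"
  using integral_linear[OF integrable_on_circle[OF assms] bounded_linear_Re]
  by (simp add: cmean_def o_def)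

lemma cmean_swap:
  fixes k :: "complex \<Rightarrow> complex \<Rightarrow> real"
  assumes "continuous_on (sphere 0 r \<times> sphere 0 s) (\<lambda>(x, y). k x y)" "r \<ge> 0" "s \<ge> 0"
  shows "cmean (\<lambda>x. cmean (\<lambda>y. k x y) s) r = cmean (\<lambda>y. cmean (\<lambda>x. k x y) r) s"
proof -
  have "continuous_on (cbox (0, 0) (2*pi, 2*pi))
          (\<lambda>(a, b). k (of_real r * cis a) (of_real s * cis b))"
    unfolding case_prod_unfold
    by (rule continuous_on_compose2[OF assms(1)[unfolded case_prod_unfold], of _ "\<lambda>p. (of_real r * cis (fst p), of_real s * cis (snd p))", simplified])
       (use assms(2,3) in \<open>auto intro!: continuous_intros simp: norm_mult\<close>)
  from integral_swap_continuous[OF this] show ?thesis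
    by (simp add: cmean_def)
qed

section \<open>The Poisson kernel and its reproducing property\<close>

text \<open>The Poisson kernel, written as the real part of a function holomorphic in
  \<open>z\<close>; \<open>pker_eq\<close> gives the classical quotient.\<close>

definition pker :: "complex \<Rightarrow> complex \<Rightarrow> real" where
  "pker z w = Re ((w + z) / (w - z))"

definition poisson :: "real \<Rightarrow> (complex \<Rightarrow> real) \<Rightarrow> complex \<Rightarrow> real" where
  "poisson R u z = cmean (\<lambda>w. pker z w * u w) R"

lemma pker_0 [simp]: "w \<noteq> 0 \<Longrightarrow> pker 0 w = 1"
  by (simp add: pker_def)

lemma poisson_0: "R > 0 \<Longrightarrow> poisson R u 0 = cmean u R"
  unfolding poisson_def by (rule cmean_cong) auto

lemma pker_eq:
  assumes "z \<noteq> w"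
  shows "pker z w = ((norm w)\<^sup>2 - (norm z)\<^sup>2) / (norm (w - z))\<^sup>2"
proof -
  have "(w + z) / (w - z) = (w + z) * cnj (w - z) / (of_real ((norm (w - z))\<^sup>2))"
    by (simp add: complex_div_cnj[of "w + z"])
  hence "pker z w = Re ((w + z) * cnj (w - z)) / (norm (w - z))\<^sup>2"
    unfolding pker_def by (metis Re_complex_of_real Re_divide_of_real)
  also have "Re ((w + z) * cnj (w - z)) = (norm w)\<^sup>2 - (norm z)\<^sup>2"
    unfolding cmod_power2 by (simp add: algebra_simps power2_eq_square)
  finally show ?thesis .
qed

lemma pker_nonneg: "norm z < norm w \<Longrightarrow> pker z w \<ge> 0"
  by (subst pker_eq) (auto simp: power_mono)

text \<open>One half of Harnack's inequality: \<open>norm (w - z)\<close> is smallest when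
  \<open>z\<close> points towards \<open>w\<close>.\<close>

lemma pker_le:
  assumes "norm z < norm w"
  shows "pker z w \<le> (norm w + norm z) / (norm w - norm z)"
proof -
  have "norm w - norm z \<le> norm (w - z)" by (rule norm_triangle_ineq2)
  hence "(norm w - norm z)\<^sup>2 \<le> (norm (w - z))\<^sup>2"
    using assms by (intro power_mono) auto
  hence "pker z w \<le> ((norm w)\<^sup>2 - (norm z)\<^sup>2) / (norm w - norm z)\<^sup>2"
    using assms by (subst pker_eq) (auto intro!: divide_left_mono mult_pos_pos power_mono)
  also have "\<dots> = (norm w + norm z) / (norm w - norm z)"
    using assms by (simp add: power2_eq_square divide_simps) (simp add: algebra_simps)
  finally show ?thesis .
qed

lemma continuous_on_pker:
  assumes "norm z < R"
  shows "continuous_on (sphere 0 R) (pker z)"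
  unfolding pker_def using assms by (auto intro!: continuous_intros)

text \<open>On the circle \<open>cnj w = R^2 / w\<close>, so the kernel splits into \<open>w\<close>
  times Cauchy's kernel at \<open>z\<close> and a term holomorphic in the closed disc.\<close>

lemma of_real_pker:
  assumes "norm w = R" "norm z < R"
  shows "of_real (pker z w) = w / (w - z) + cnj z * w / (of_real (R\<^sup>2) - cnj z * w)"
proof -
  have wz: "w - z \<noteq> 0" and w0: "w \<noteq> 0" using assms by auto
  have cwz: "cnj w - cnj z \<noteq> 0"
    using wz by (metis complex_cnj_diff complex_cnj_zero_iff)
  have "(w + z) / (w - z) = 1 + 2 * (z / (w - z))"
    using wz by (simp add: field_simps)
  hence "pker z w = Re (1 + 2 * (z / (w - z)))" by (simp only: pker_def)
  also have "\<dots> = 1 + 2 * Re (z / (w - z))"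
    by (simp only: plus_complex.sel one_complex.sel mult_2)
  finally have "(of_real (pker z w) :: complex) = 1 + of_real (2 * Re (z / (w - z)))"
    by (simp only: of_real_add of_real_1)
  also have "\<dots> = 1 + (z / (w - z) + cnj (z / (w - z)))"
    by (subst complex_add_cnj) simp
  also have "\<dots> = (1 + z / (w - z)) + cnj z / (cnj w - cnj z)"
    by simp
  also have "1 + z / (w - z) = w / (w - z)"
    using wz by (simp add: field_simps)
  also have "cnj z / (cnj w - cnj z) = cnj z * w / (w * cnj w - cnj z * w)"
    using w0 cwz by (simp add: divide_simps) (simp add: algebra_simps)
  also have "w * cnj w = of_real (R\<^sup>2)"
    using assms(1) complex_norm_square[of w] by (simp del: of_real_power)
  finally show ?thesis .
qed

text \<open>In the splitting \<open>of_real_pker\<close>, the Cauchy kernel reproduces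
  \<open>q z\<close>, while the second term integrates to zero by Cauchy's theorem.\<close>

lemma cmean_pker_holomorphic:
  assumes "q holomorphic_on ball 0 S" "norm z < R" "R < S"
  shows "cmean (\<lambda>w. of_real (pker z w) * q w) R = q z"
proof -
  have R: "R > 0" using assms(2) le_less_trans norm_ge_zero by blast
  have q: "q holomorphic_on cball 0 R"
    by (rule holomorphic_on_subset[OF assms(1)]) (use assms(3) in auto)
  \<comment> \<open>The expression could vanish only at the reflection of \<open>z\<close> in the
    circle, which lies outside the closed disc.\<close>
  have *: "of_real (R\<^sup>2) - cnj z * w \<noteq> 0" if "w \<in> cball 0 R" for w
  proof
    assume "of_real (R\<^sup>2) - cnj z * w = 0"
    hence "norm (of_real (R\<^sup>2) :: complex) = norm (cnj z * w)" by (metis eq_iff_diff_eq_0)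
    hence "R * R = norm z * norm w" by (simp add: norm_mult power2_eq_square norm_power)
    moreover have "norm z * norm w < R * R"
    proof -
      have "norm z * norm w \<le> norm z * R" by (rule mult_left_mono) (use that in auto)
      also have "\<dots> < R * R" using assms(2) R by simp
      finally show ?thesis .
    qed
    ultimately show False by simp
  qed
  have "((\<lambda>w. q w / (w - z)) has_contour_integral (2 * of_real pi * \<i> * q z)) (circlepath 0 R)"
    by (rule Cauchy_integral_circlepath_simple[OF q]) (use assms in auto)
  moreover have "(\<lambda>w. cnj z * q w / (of_real (R\<^sup>2) - cnj z * w)) holomorphic_on cball 0 R"
    by (intro holomorphic_intros q) (use * in blast)
  hence "((\<lambda>w. cnj z * q w / (of_real (R\<^sup>2) - cnj z * w)) has_contour_integral 0) (circlepath 0 R)"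
    by (rule Cauchy_theorem_convex_simple) (use R in auto)
  ultimately have "((\<lambda>w. q w / (w - z) + cnj z * q w / (of_real (R\<^sup>2) - cnj z * w))
      has_contour_integral (2 * of_real pi * \<i> * q z)) (circlepath 0 R)"
    using has_contour_integral_add by fastforce
  \<comment> \<open>\<open>dw = i w dt\<close> supplies the factor \<open>w\<close> that both terms
    of \<open>of_real_pker\<close> carry.\<close>
  hence "((\<lambda>t. (q (R * cis t) / (R * cis t - z) + cnj z * q (R * cis t) / (of_real (R\<^sup>2) - cnj z * (R * cis t))) * R * \<i> * cis t)
      has_integral (2 * of_real pi * \<i> * q z)) {0..2*pi}"
    unfolding circlepath_def by (subst (asm) has_contour_integral_part_circlepath_iff) simp_all
  moreover have "(q (R * cis t) / (R * cis t - z) + cnj z * q (R * cis t) / (of_real (R\<^sup>2) - cnj z * (R * cis t))) * R * \<i> * cis t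
     = \<i> * (of_real (pker z (R * cis t)) * q (R * cis t))" for t
    using R assms(2) by (subst of_real_pker[of _ R]) (simp_all add: norm_mult algebra_simps add_divide_distrib)
  ultimately have "((\<lambda>t. \<i> * (of_real (pker z (R * cis t)) * q (R * cis t))) has_integral (2 * of_real pi * \<i> * q z)) {0..2*pi}"
    by (simp only:)
  hence "\<i> * integral {0..2*pi} (\<lambda>t. of_real (pker z (R * cis t)) * q (R * cis t)) = 2 * of_real pi * \<i> * q z"
    by (metis integral_unique integral_mult_right)
  hence "integral {0..2*pi} (\<lambda>t. of_real (pker z (R * cis t)) * q (R * cis t)) = 2 * of_real pi * q z"
    by simp
  thus ?thesis
    unfolding cmean_def by (simp add: scaleR_conv_of_real)
qed

lemma poisson_Re_holomorphic:
  assumes "q holomorphic_on ball 0 S" "norm z < R" "R < S"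
  shows "poisson R (\<lambda>w. Re (q w)) z = Re (q z)"
proof -
  have R: "R > 0" using assms(2) le_less_trans norm_ge_zero by blast
  have "continuous_on (sphere 0 R) q"
    by (rule holomorphic_on_imp_continuous_on, rule holomorphic_on_subset[OF assms(1)]) (use assms in auto)
  hence "continuous_on (sphere 0 R) (\<lambda>w. of_real (pker z w) * q w)"
    using continuous_on_pker[OF assms(2)] by (intro continuous_intros)
  from Re_cmean[OF this] R show ?thesis
    unfolding poisson_def using cmean_pker_holomorphic[OF assms] by simp
qed

lemma cmean_Re_holomorphic:
  assumes "q holomorphic_on ball 0 S" "0 < R" "R < S"
  shows "cmean (\<lambda>w. Re (q w)) R = Re (q 0)"
  using poisson_Re_holomorphic[of q S 0 R] poisson_0[of R] assms by simp

lemma poisson_mono: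
  assumes "continuous_on (sphere 0 R) u" "continuous_on (sphere 0 R) v" "norm z < R"
    and "\<And>w. norm w = R \<Longrightarrow> u w \<le> v w"
  shows "poisson R u z \<le> poisson R v z"
proof -
  have R: "R > 0" using assms(3) le_less_trans norm_ge_zero by blast
  show ?thesis unfolding poisson_def
    by (rule cmean_mono)
       (use R assms in \<open>auto intro!: continuous_intros continuous_on_pker mult_left_mono pker_nonneg\<close>)
qed

lemma poisson_const: "norm z < R \<Longrightarrow> poisson R (\<lambda>_. c) z = c"
  using poisson_Re_holomorphic[of "\<lambda>_. of_real c" "R + 1" z R] by simp

lemma poisson_add:
  assumes "continuous_on (sphere 0 R) u" "continuous_on (sphere 0 R) v" "norm z < R"
  shows "poisson R (\<lambda>w. u w + v w) z = poisson R u z + poisson R v z"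
proof -
  have R: "R > 0" using assms(3) le_less_trans norm_ge_zero by blast
  show ?thesis unfolding poisson_def distrib_left
    by (rule cmean_add) (use R assms in \<open>auto intro!: continuous_intros continuous_on_pker\<close>)
qed

lemma poisson_diff:
  assumes "continuous_on (sphere 0 R) u" "continuous_on (sphere 0 R) v" "norm z < R"
  shows "poisson R (\<lambda>w. u w - v w) z = poisson R u z - poisson R v z"
proof -
  have "poisson R (\<lambda>w. (u w - v w) + v w) z = poisson R (\<lambda>w. u w - v w) z + poisson R v z"
    using assms by (intro poisson_add continuous_intros)
  thus ?thesis by simp
qed

text \<open>On a circle \<open>cnj w = R\<^sup>2 / w\<close>, so the negative powers of \<open>w\<close> that arise in a product
  of real parts can be conjugated into positive ones.\<close>

lemma Re_poly_cnj_poly_on_sphere: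
  "\<exists>s. \<forall>w\<in>sphere 0 R. Re (poly p w * cnj (poly q w)) = Re (poly s w)"
proof (induction p arbitrary: q)
  case 0
  show ?case by (rule exI[of _ 0]) simp
next
  case (pCons a p)
  obtain b q' where q: "q = pCons b q'" by (cases q) auto
  from pCons.IH[of q'] obtain s
    where s: "\<And>w. w \<in> sphere 0 R \<Longrightarrow> Re (poly p w * cnj (poly q' w)) = Re (poly s w)" by blast
  \<comment> \<open>With the constant terms \<open>a\<close> and \<open>b\<close> split off, the
    product has three summands: \<open>a * cnj q\<close>, which is conjugated,
    \<open>cnj b * w * p\<close>, and \<open>w * cnj w = R^2\<close> times the product covered by
    the induction hypothesis.\<close>
  show ?case
  proof (intro exI[of _ "smult (cnj a) q + smult (cnj b) (pCons 0 p) + smult (of_real (R\<^sup>2)) s"] ballI)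
    fix w :: complex assume w: "w \<in> sphere 0 R"
    have ww: "w * cnj w = of_real (R\<^sup>2)"
      using w complex_norm_square[of w] by (simp del: of_real_power)
    have "poly (pCons a p) w * cnj (poly q w)
        = a * cnj (poly q w) + cnj b * (w * poly p w) + (w * cnj w) * (poly p w * cnj (poly q' w))"
      by (simp add: q algebra_simps)
    hence "Re (poly (pCons a p) w * cnj (poly q w))
        = Re (a * cnj (poly q w)) + Re (cnj b * (w * poly p w)) + R\<^sup>2 * Re (poly p w * cnj (poly q' w))"
      unfolding ww by (simp only: plus_complex.sel scaleR_complex.sel flip: scaleR_conv_of_real)
    also have "Re (a * cnj (poly q w)) = Re (cnj a * poly q w)" by simp
    also have "Re (poly p w * cnj (poly q' w)) = Re (poly s w)" by (rule s[OF w])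
    also have "R\<^sup>2 * Re (poly s w) = Re (of_real (R\<^sup>2) * poly s w)"
      by (simp only: scaleR_complex.sel flip: scaleR_conv_of_real)
    finally show "Re (poly (pCons a p) w * cnj (poly q w)) =
      Re (poly (smult (cnj a) q + smult (cnj b) (pCons 0 p) + smult (of_real (R\<^sup>2)) s) w)"
      by (simp only: poly_add poly_smult poly_pCons plus_complex.sel add_0)
  qed
qed

text \<open>Makes Stone-Weierstrass approximants harmonic: on the circle each is the real part of a
  complex polynomial, so its Poisson integral is known.\<close>

lemma real_polynomial_function_on_sphere:
  fixes g :: "complex \<Rightarrow> real"
  assumes "real_polynomial_function g"
  shows "\<exists>q. \<forall>w\<in>sphere 0 R. g w = Re (poly q w)"
  using assms
proof induction
  case (linear f)
  then interpret bounded_linear f .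
  have "f w = Re (poly [:0, of_real (f 1) - \<i> * of_real (f \<i>):] w)" for w
  proof -
    have "w = Re w *\<^sub>R 1 + Im w *\<^sub>R \<i>" by (simp add: complex_eq_iff)
    hence "f w = Re w * f 1 + Im w * f \<i>" by (metis add scaleR real_scaleR_def)
    thus ?thesis by (simp add: algebra_simps)
  qed
  thus ?case by blast
next
  case (const c)
  show ?case by (rule exI[of _ "[:of_real c:]"]) simp
next
  case (add f g)
  then obtain p q where "\<forall>w\<in>sphere 0 R. f w = Re (poly p w)" "\<forall>w\<in>sphere 0 R. g w = Re (poly q w)"
    by blast
  thus ?case by (intro exI[of _ "p + q"]) simp
next
  case (mult f g)
  then obtain p q where pq: "\<forall>w\<in>sphere 0 R. f w = Re (poly p w)" "\<forall>w\<in>sphere 0 R. g w = Re (poly q w)"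
    by blast
  obtain s where s: "\<forall>w\<in>sphere 0 R. Re (poly p w * cnj (poly q w)) = Re (poly s w)"
    using Re_poly_cnj_poly_on_sphere by blast
  \<comment> \<open>The witness comes from
    \<open>2 * Re a * Re b = Re (a * b) + Re (a * cnj b)\<close>.\<close>
  show ?case
  proof (intro exI[of _ "smult (1/2) (p * q + s)"] ballI)
    fix w :: complex assume w: "w \<in> sphere 0 R"
    have "Re (poly (smult (1/2) (p * q + s)) w) = (Re (poly p w * poly q w) + Re (poly s w)) / 2"
      by (simp add: complex_eq_iff)
    also have "\<dots> = (Re (poly p w * poly q w) + Re (poly p w * cnj (poly q w))) / 2"
      using s w by metis
    also have "\<dots> = Re (poly p w) * Re (poly q w)" by simp
    finally show "f w * g w = Re (poly (smult (1/2) (p * q + s)) w)" using pq w by simp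
  qed
qed

text \<open>Approximate \<open>u\<close> on the circle by \<open>Re q\<close> with a polynomial
  \<open>q\<close> and apply the maximum principle to \<open>G * exp (- q)\<close>. No logarithm of
  \<open>G\<close> is taken, so its zeros do no harm.\<close>

lemma norm_le_exp_poisson:
  assumes hol: "G holomorphic_on UNIV" and u: "continuous_on (sphere 0 R) u"
    and le: "\<And>w. norm w = R \<Longrightarrow> norm (G w) \<le> exp (u w)" and z: "norm z < R"
  shows "norm (G z) \<le> exp (poisson R u z)"
proof -
  have R: "R > 0" using z le_less_trans norm_ge_zero by blast
  \<comment> \<open>One \<open>e\<close> is lost on the boundary, where \<open>u\<close> is compared
    with \<open>g\<close>, the other when \<open>Re q\<close> is replaced by \<open>u + e\<close> in
    the Poisson integral.\<close>
  have main: "norm (G z) \<le> exp (poisson R u z + 2 * e)" if e: "e > 0" for e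
  proof -
    obtain g where g: "real_polynomial_function g" "\<And>x. x \<in> sphere 0 R \<Longrightarrow> \<bar>u x - g x\<bar> < e"
      using Stone_Weierstrass_real_polynomial_function[OF compact_sphere u e] by blast
    obtain q where q: "\<And>w. w \<in> sphere 0 R \<Longrightarrow> g w = Re (poly q w)"
      using real_polynomial_function_on_sphere[OF g(1)] by blast
    have cq: "continuous_on A (\<lambda>w. Re (poly q w))" for A by (intro continuous_intros)
    have "norm (G z * exp (- poly q z)) \<le> exp e"
    proof (rule maximum_modulus_frontier[of "\<lambda>w. G w * exp (- poly q w)" "cball 0 R"])
      show "(\<lambda>w. G w * exp (- poly q w)) holomorphic_on interior (cball 0 R)"
        by (intro holomorphic_intros holomorphic_on_subset[OF hol]) auto
      show "continuous_on (closure (cball 0 R)) (\<lambda>w. G w * exp (- poly q w))"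
        by (intro continuous_intros continuous_on_subset[OF holomorphic_on_imp_continuous_on[OF hol]]) auto
      fix w assume "w \<in> frontier (cball (0::complex) R)"
      hence w: "norm w = R" using R by auto
      have "norm (G w * exp (- poly q w)) = norm (G w) * exp (- g w)"
        using q[of w] w by (simp add: norm_mult)
      also have "\<dots> \<le> exp (u w) * exp (- g w)"
        by (intro mult_right_mono le w) auto
      also have "\<dots> \<le> exp e"
        using g(2)[of w] w by (simp flip: exp_add)
      finally show "norm (G w * exp (- poly q w)) \<le> exp e" .
    qed (use z in auto)
    hence "norm (G z) \<le> exp (Re (poly q z) + e)"
      by (simp add: norm_mult norm_divide exp_add exp_minus field_simps)
    also have "Re (poly q z) = poisson R (\<lambda>w. Re (poly q w)) z"
      by (rule poisson_Re_holomorphic[symmetric, of _ "R + 1"]) (use z in \<open>auto intro!: holomorphic_intros\<close>)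
    also have "\<dots> \<le> poisson R (\<lambda>w. u w + e) z"
      by (rule poisson_mono[OF cq]) (use u z g(2) q in \<open>force intro!: continuous_intros\<close>)+
    also have "\<dots> = poisson R u z + e"
      using poisson_add[OF u continuous_on_const z] poisson_const[OF z] by simp
    finally show ?thesis by (simp add: add.commute)
  qed
  have "((\<lambda>e. exp (poisson R u z + 2 * e)) \<longlongrightarrow> exp (poisson R u z + 2 * 0)) (at_right 0)"
    by (intro tendsto_intros)
  thus ?thesis
    by (intro tendsto_lowerbound[where F = "at_right 0" and f = "\<lambda>e. exp (poisson R u z + 2 * e)"])
       (auto simp: eventually_at_right_less intro!: eventually_mono[OF eventually_at_right_less] main)
qed

section \<open>Functions dominated by their Poisson integrals\<close>

lemma cmean_kernel_swap:
  assumes "continuous_on (sphere 0 r) a" "continuous_on (sphere 0 R) u"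
    and "continuous_on (sphere 0 r \<times> sphere 0 R) (\<lambda>(x, y). k x y)" "r \<ge> 0" "R \<ge> 0"
  shows "cmean (\<lambda>x. a x * cmean (\<lambda>y. k x y * u y) R) r
       = cmean (\<lambda>y. cmean (\<lambda>x. a x * k x y) r * (u y :: real)) R"
proof -
  have "continuous_on (sphere 0 r \<times> sphere 0 R) (\<lambda>(x, y). a x * (k x y * u y))"
    using assms(3) unfolding case_prod_unfold
    by (intro continuous_intros continuous_on_compose2[OF assms(1)] continuous_on_compose2[OF assms(2)]) auto
  from cmean_swap[OF this assms(4,5)]
  have "cmean (\<lambda>x. a x * cmean (\<lambda>y. k x y * u y) R) r = cmean (\<lambda>y. cmean (\<lambda>x. u y * (a x * k x y)) r) R"
    by (simp add: cmean_cmult mult_ac)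
  thus ?thesis unfolding cmean_cmult by (simp add: mult.commute)
qed

lemma continuous_on_pker_prod:
  assumes "continuous_on A f" "continuous_on A g" "\<And>p. p \<in> A \<Longrightarrow> f p \<noteq> g p"
  shows "continuous_on A (\<lambda>p. pker (f p) (g p))"
  unfolding pker_def by (intro continuous_intros assms) (metis assms(3) right_minus_eq)

lemma continuous_on_cmean:
  assumes "continuous_on (A \<times> sphere 0 R) (\<lambda>(x, y). k x y)" "R \<ge> 0"
  shows "continuous_on A (\<lambda>x. cmean (k x) R)"
proof -
  have "continuous_on (A \<times> cbox 0 (2*pi)) (\<lambda>(x, t). k x (of_real R * cis t))"
    unfolding case_prod_unfold
    by (rule continuous_on_compose2[OF assms(1)[unfolded case_prod_unfold], of _ "\<lambda>p. (fst p, of_real R * cis (snd p))", simplified])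
       (use assms(2) in \<open>auto intro!: continuous_intros simp: norm_mult\<close>)
  from integral_continuous_on_param[OF this] show ?thesis
    unfolding cmean_def by (auto intro!: continuous_intros)
qed

lemma continuous_on_poisson:
  assumes "continuous_on (sphere 0 R) u" "A \<subseteq> ball 0 R"
  shows "continuous_on A (poisson R u)"
proof (cases "A = {}")
  case False
  hence "R \<ge> 0" using assms(2) by (metis ball_empty not_le_imp_less order_less_imp_le subset_empty)
  moreover have "continuous_on (A \<times> sphere 0 R) (\<lambda>(x, y). pker x y * u y)"
    unfolding case_prod_unfold
    by (intro continuous_intros continuous_on_pker_prod continuous_on_compose2[OF assms(1)])
       (use assms(2) in force)+
  ultimately show ?thesis unfolding poisson_def by (intro continuous_on_cmean)
qed auto

lemma cmean_pker_holomorphic_param: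
  assumes "q holomorphic_on ball 0 S" "norm z < A" "A < S"
    and "\<And>x. x \<in> ball 0 S \<Longrightarrow> norm (q x) < norm y"
  shows "cmean (\<lambda>x. pker z x * pker (q x) y) A = pker (q z) y"
proof -
  have "poisson A (\<lambda>x. Re ((y + q x) / (y - q x))) z = Re ((y + q z) / (y - q z))"
    by (rule poisson_Re_holomorphic[where S = S]) (use assms in \<open>force intro!: holomorphic_intros\<close>)+
  thus ?thesis unfolding poisson_def pker_def .
qed

text \<open>After Fubini the inner mean acts on \<open>pker (q x) y\<close>, which is the real part
  of a holomorphic function of \<open>x\<close> and is reproduced at \<open>z\<close>.\<close>

lemma poisson_poisson_compose:
  assumes u: "continuous_on (sphere 0 R) u" and q: "q holomorphic_on ball 0 S"
    and z: "norm z < A" and AS: "A < S" and qR: "\<And>x. x \<in> ball 0 S \<Longrightarrow> norm (q x) < R"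
  shows "poisson A (\<lambda>x. poisson R u (q x)) z = poisson R u (q z)"
proof -
  have A: "A > 0" using z le_less_trans norm_ge_zero by blast
  have zS: "z \<in> ball 0 S" using z AS by auto
  have R: "R > 0" using qR[OF zS] le_less_trans norm_ge_zero by blast
  have sub: "sphere 0 A \<subseteq> ball 0 S" using AS by auto
  have cq: "continuous_on (sphere 0 A) q"
    by (rule holomorphic_on_imp_continuous_on, rule holomorphic_on_subset[OF q sub])
  have "poisson A (\<lambda>x. poisson R u (q x)) z
      = cmean (\<lambda>x. pker z x * cmean (\<lambda>y. pker (q x) y * u y) R) A"
    by (simp add: poisson_def)
  also have "\<dots> = cmean (\<lambda>y. cmean (\<lambda>x. pker z x * pker (q x) y) A * u y) R"
  proof (rule cmean_kernel_swap[OF continuous_on_pker[OF z] u])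
    show "continuous_on (sphere 0 A \<times> sphere 0 R) (\<lambda>(x, y). pker (q x) y)"
      unfolding case_prod_unfold
    proof (intro continuous_on_pker_prod continuous_intros continuous_on_compose2[OF cq])
      fix p assume "p \<in> sphere (0::complex) A \<times> sphere (0::complex) R"
      thus "q (fst p) \<noteq> snd p" using qR[of "fst p"] AS by auto
    qed auto
  qed (use A R in auto)
  also have "\<dots> = cmean (\<lambda>y. pker (q z) y * u y) R"
    
  proof (rule cmean_cong)
    fix y assume "norm (y::complex) = R"
    thus "cmean (\<lambda>x. pker z x * pker (q x) y) A * u y = pker (q z) y * u y"
      using cmean_pker_holomorphic_param[OF q z AS] qR by simp
  qed (use R in auto)
  finally show ?thesis by (simp add: poisson_def)
qed

lemma poisson_poisson:
  assumes "continuous_on (sphere 0 R) u" "norm z < A" "A < R"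
  shows "poisson A (poisson R u) z = poisson R u z"
  using poisson_poisson_compose[of R u "\<lambda>x. x" R z A] assms by (auto intro: holomorphic_intros)

section \<open>Subharmonicity in Poisson form\<close>

text \<open>Continuous subharmonicity, encoded as domination at every point of every disc about the
  origin; the off-centre points are where Harnack's inequality and polynomial preimages
  enter.\<close>

definition poisson_sub :: "(complex \<Rightarrow> real) \<Rightarrow> bool" where
  "poisson_sub u \<longleftrightarrow> continuous_on UNIV u \<and> (\<forall>R z. norm z < R \<longrightarrow> u z \<le> poisson R u z)"

lemma poisson_sub_continuous: "poisson_sub u \<Longrightarrow> continuous_on A u"
  unfolding poisson_sub_def using continuous_on_subset by blast

lemma poisson_subD: "poisson_sub u \<Longrightarrow> norm z < R \<Longrightarrow> u z \<le> poisson R u z"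
  unfolding poisson_sub_def by blast

text \<open>\<open>norm_le_exp_poisson\<close> bounds both functions by the same Poisson integral,
  hence their maximum. The absence of common zeros keeps the logarithm continuous.\<close>

lemma poisson_sub_ln_max:
  assumes "g holomorphic_on UNIV" "h holomorphic_on UNIV" "\<And>z. g z \<noteq> 0 \<or> h z \<noteq> 0"
  shows "poisson_sub (\<lambda>z. ln (max (norm (g z)) (norm (h z))))" (is "poisson_sub ?u")
  unfolding poisson_sub_def
proof (intro conjI allI impI)
  have pos: "max (norm (g z)) (norm (h z)) > 0" for z using assms(3)[of z] by (auto simp: less_max_iff_disj)
  show c: "continuous_on UNIV ?u"
    using pos by (intro continuous_intros holomorphic_on_imp_continuous_on assms) (auto simp: less_le)
  fix R z assume z: "norm (z::complex) < R"
  have "norm (G z) \<le> exp (poisson R ?u z)" if "G \<in> {g, h}" for G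
    using that pos by (intro norm_le_exp_poisson continuous_on_subset[OF c] z) (use assms in auto)
  hence "max (norm (g z)) (norm (h z)) \<le> exp (poisson R ?u z)" by auto
  thus "?u z \<le> poisson R ?u z"
    using pos[of z] by (metis exp_gt_zero ln_exp ln_le_cancel_iff)
qed

text \<open>On the smaller circle \<open>u\<close> is at most \<open>poisson R u\<close>, whose mean
  there is its value at the centre.\<close>

lemma cmean_mono_radius:
  assumes "poisson_sub u" "0 < A" "A \<le> R"
  shows "cmean u A \<le> cmean u R"
proof (cases "A = R")
  case False
  have "cmean u A \<le> cmean (poisson R u) A"
    using assms False by (intro cmean_mono continuous_on_poisson poisson_sub_continuous poisson_subD) auto
  also have "\<dots> = poisson A (poisson R u) 0"
    using poisson_0 assms by simp
  also have "\<dots> = cmean u R"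
    using assms False by (subst poisson_poisson) (auto simp: poisson_0 poisson_sub_continuous)
  finally show ?thesis .
qed simp

text \<open>\<open>poisson R u - u\<close> is nonnegative on the circle of radius \<open>A\<close>,
  so its Poisson integral at \<open>z\<close> is at most Harnack's factor times its mean, whatever
  the sign of \<open>u\<close>.\<close>

lemma poisson_harnack:
  assumes u: "poisson_sub u" and z: "norm z < A" and AR: "A < R"
  shows "poisson R u z \<le> poisson A u z + (A + norm z) / (A - norm z) * (cmean u R - cmean u A)"
proof -
  have A: "A > 0" using z le_less_trans norm_ge_zero by blast
  let ?d = "\<lambda>x. poisson R u x - u x"
  have cu: "continuous_on S u" for S using u by (rule poisson_sub_continuous)
  have cp: "continuous_on (sphere 0 A) (poisson R u)"
    by (rule continuous_on_poisson[OF cu]) (use AR in auto)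
  have cd: "continuous_on (sphere 0 A) ?d" by (intro continuous_intros cp cu)
  have "poisson R u z - poisson A u z = poisson A ?d z"
    by (subst poisson_diff) (use z AR cu cp in \<open>auto simp: poisson_poisson\<close>)
  also have "\<dots> \<le> cmean (\<lambda>x. (A + norm z) / (A - norm z) * ?d x) A"
    unfolding poisson_def[of A ?d z]
  proof (rule cmean_mono)
    fix w :: complex assume w: "norm w = A"
    show "pker z w * ?d w \<le> (A + norm z) / (A - norm z) * ?d w"
      using pker_le[of z w] w z AR poisson_subD[OF u, of w R] by (intro mult_right_mono) auto
  qed (use A z cd in \<open>auto intro!: continuous_intros continuous_on_pker\<close>)
  also have "\<dots> = (A + norm z) / (A - norm z) * cmean ?d A" by (rule cmean_cmult)
  also have "cmean ?d A = cmean (poisson R u) A - cmean u A"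
    by (rule cmean_diff) (use A cp cu in auto)
  also have "cmean (poisson R u) A = poisson A (poisson R u) 0" using A by (simp add: poisson_0)
  also have "\<dots> = cmean u R"
    using A AR cu by (subst poisson_poisson) (auto simp: poisson_0)
  finally show ?thesis by simp
qed

text \<open>Harnack's inequality with \<open>A\<close> fixed once its factor is below
  \<open>1 + d\<close>; what depends on \<open>A\<close> alone goes into \<open>C\<close>, which is
  thus independent of \<open>R\<close>.\<close>

lemma poisson_le_cmean_asymp:
  assumes u: "poisson_sub u" and d: "d > 0"
  shows "\<exists>C R0. \<forall>R>R0. poisson R u z \<le> (1 + d) * cmean u R + C"
proof -
  have "((\<lambda>A. (A + norm z) / (A - norm z)) \<longlongrightarrow> 1) at_top" by real_asymp
  hence "\<forall>\<^sub>F A in at_top. (A + norm z) / (A - norm z) < 1 + d \<and> A > norm z"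
    using d by (intro eventually_conj order_tendstoD eventually_gt_at_top) auto
  then obtain A where A: "(A + norm z) / (A - norm z) < 1 + d" "A > norm z"
    by (metis (no_types, lifting) eventually_happens' trivial_limit_at_top_linorder)
  have A0: "A > 0" using A(2) le_less_trans norm_ge_zero by blast
  show ?thesis
  proof (intro exI allI impI)
    fix R assume R: "R > A"
    have "poisson R u z \<le> poisson A u z + (A + norm z) / (A - norm z) * (cmean u R - cmean u A)"
      by (rule poisson_harnack[OF u A(2) R])
    also have "\<dots> \<le> poisson A u z + (1 + d) * (cmean u R - cmean u A)"
      using A cmean_mono_radius[OF u A0, of R] R by (intro add_left_mono mult_right_mono) auto
    finally show "poisson R u z \<le> (1 + d) * cmean u R + (poisson A u z - (1 + d) * cmean u A)"
      by (simp add: algebra_simps)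
  qed
qed

text \<open>\<open>u\<close> is at most \<open>poisson R u\<close>; composed with \<open>q\<close>,
  the latter is harmonic, and its circle mean is the value at \<open>q 0\<close>.\<close>

lemma cmean_compose_le_poisson:
  assumes u: "poisson_sub u" and q: "q holomorphic_on ball 0 S" and r: "0 < r" "r < S"
    and qR: "\<And>x. x \<in> ball 0 S \<Longrightarrow> norm (q x) < R"
  shows "cmean (\<lambda>x. u (q x)) r \<le> poisson R u (q 0)"
proof -
  have cu: "continuous_on A u" for A using u by (rule poisson_sub_continuous)
  have sub: "sphere 0 r \<subseteq> ball 0 S" using r by auto
  have cq: "continuous_on (sphere 0 r) q"
    by (rule holomorphic_on_imp_continuous_on, rule holomorphic_on_subset[OF q sub])
  have "cmean (\<lambda>x. u (q x)) r \<le> cmean (\<lambda>x. poisson R u (q x)) r"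
  proof (rule cmean_mono)
    show "continuous_on (sphere 0 r) (\<lambda>x. u (q x))"
      by (rule continuous_on_compose2[OF cu cq]) auto
    show "continuous_on (sphere 0 r) (\<lambda>x. poisson R u (q x))"
    proof (rule continuous_on_compose2[OF continuous_on_poisson[OF cu] cq])
      show "q ` sphere 0 r \<subseteq> ball 0 R" using qR sub by auto
    qed auto
  qed (use r qR sub poisson_subD[OF u] in auto)
  also have "\<dots> = poisson r (\<lambda>x. poisson R u (q x)) 0"
    using r by (simp add: poisson_0)
  also have "\<dots> = poisson R u (q 0)"
    using r qR by (intro poisson_poisson_compose[OF cu q]) auto
  finally show ?thesis .
qed

section \<open>Kernel sums over the preimages under a polynomial\<close>

lemma poly_pderiv_prod_mset:
  fixes y :: "'a::field"
  assumes "y \<notin># M"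
  shows "poly (pderiv (\<Prod>x\<in>#M. [:-x, 1:])) y = poly (\<Prod>x\<in>#M. [:-x, 1:]) y * (\<Sum>x\<in>#M. 1 / (y - x))"
  using assms
proof (induction M)
  case (add a M)
  hence ya: "y - a \<noteq> 0" and IH: "poly (pderiv (\<Prod>x\<in>#M. [:-x, 1:])) y = poly (\<Prod>x\<in>#M. [:-x, 1:]) y * (\<Sum>x\<in>#M. 1 / (y - x))"
    by auto
  have "poly (pderiv (\<Prod>x\<in>#add_mset a M. [:-x, 1:])) y
      = (y - a) * poly (pderiv (\<Prod>x\<in>#M. [:-x, 1:])) y + poly (\<Prod>x\<in>#M. [:-x, 1:]) y"
    by (simp only: image_mset_add_mset prod_mset.add_mset pderiv_mult poly_add poly_mult)
       (simp add: pderiv_pCons)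
  also have "\<dots> = (y - a) * poly (\<Prod>x\<in>#M. [:-x, 1:]) y * (1 / (y - a) + (\<Sum>x\<in>#M. 1 / (y - x)))"
    using ya unfolding IH by (simp add: field_simps)
  also have "(y - a) * poly (\<Prod>x\<in>#M. [:-x, 1:]) y = poly (\<Prod>x\<in>#add_mset a M. [:-x, 1:]) y"
    by (simp only: image_mset_add_mset prod_mset.add_mset poly_mult) simp
  finally show ?case by simp
qed simp

lemma degree_diff_const:
  assumes "degree Q > 0"
  shows "degree (Q - [:w:]) = degree (Q :: 'a::ab_group_add poly)"
proof -
  have eq: "Q - [:w:] = Q + [:-w:]" by (rule poly_eqI) (simp add: coeff_pCons split: nat.split)
  show ?thesis unfolding eq by (rule degree_add_eq_left) (use assms in simp)
qed

text \<open>Write \<open>(y + z) / (y - z) = 2 * y / (y - z) - 1\<close>; summed over the roots of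
  \<open>Q - [:w:]\<close>, the first terms form a logarithmic derivative and the \<open>-1\<close>
  terms count the degree.\<close>

lemma sum_pker_proots:
  fixes Q :: "complex poly"
  assumes "poly Q y \<noteq> w" "degree Q > 0"
  shows "(\<Sum>z\<in>#proots (Q - [:w:]). pker z y)
       = Re (2 * y * poly (pderiv Q) y / (poly Q y - w) - of_nat (degree Q))"
proof -
  let ?P = "Q - [:w:]"
  have P0: "?P \<noteq> 0" using assms(1) by auto
  have deg: "degree ?P = degree Q"
    using assms(2) by (rule degree_diff_const)
  have size: "size (proots ?P) = degree Q"
    using deg size_proots_complex by auto
  have y: "y \<notin># proots ?P" using P0 assms(1) by simp
  let ?M = "proots ?P"
  have "pderiv Q = pderiv ?P" by (simp add: pderiv_diff pderiv_pCons)
  also have "\<dots> = smult (lead_coeff ?P) (pderiv (\<Prod>x\<in>#?M. [:-x, 1:]))"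
    by (subst complex_poly_decompose_multiset[of ?P, symmetric]) (simp only: pderiv_smult)
  finally have "poly (pderiv Q) y = lead_coeff ?P * poly (\<Prod>x\<in>#?M. [:-x, 1:]) y * (\<Sum>x\<in>#?M. 1 / (y - x))"
    using poly_pderiv_prod_mset[OF y] by simp
  also have "lead_coeff ?P * poly (\<Prod>x\<in>#?M. [:-x, 1:]) y = poly ?P y"
    by (subst (3) complex_poly_decompose_multiset[of ?P, symmetric]) simp
  finally have *: "poly (pderiv Q) y / (poly Q y - w) = (\<Sum>x\<in>#?M. 1 / (y - x))"
    using assms(1) by simp
  have "(\<Sum>z\<in>#M. pker z y) = Re (2 * y * (\<Sum>x\<in>#M. 1 / (y - x)) - of_nat (size M))" if "y \<notin># M" for M
    using that
  proof (induction M)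
    case (add a M)
    hence "y - a \<noteq> 0" by auto
    hence "(y + a) / (y - a) = 2 * y * (1 / (y - a)) - 1" by (simp add: field_simps)
    hence "pker a y = Re (2 * y * (1 / (y - a)) - 1)" by (simp only: pker_def)
    with add show ?case by (simp only: image_mset_add_mset sum_mset.add_mset) (simp add: algebra_simps)
  qed simp
  from this[OF y] show ?thesis by (simp only: size flip: *) simp
qed

lemma sum_mset_poisson:
  assumes "\<And>z. z \<in># M \<Longrightarrow> norm z < r" "continuous_on (sphere 0 r) v" "r \<ge> 0"
  shows "(\<Sum>z\<in>#M. poisson r v z) = cmean (\<lambda>y. (\<Sum>z\<in>#M. pker z y) * v y) r
     \<and> continuous_on (sphere 0 r) (\<lambda>y. \<Sum>z\<in>#M. pker z y)"
  using assms(1)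
proof (induction M)
  case (add a M)
  have "continuous_on (sphere 0 r) (pker a)" by (rule continuous_on_pker) (use add in auto)
  with add assms(2,3) show ?case
    by (auto simp: distrib_right cmean_add continuous_intros poisson_def)
qed simp

text \<open>Summed over the preimages \<open>z\<close> of \<open>w\<close> under \<open>Q\<close>, the kernel \<open>(y + z) / (y - z)\<close> becomes
  \<open>2 y Q'(y) / (Q y - w) - deg Q\<close>, which is holomorphic in \<open>w\<close>; so its mean over a circle is its
  value at \<open>w = 0\<close>, a sum over the zeros of \<open>Q\<close>.\<close>

lemma cmean_le_sum_poisson:
  fixes Q :: "complex poly"
  assumes v: "poisson_sub (\<lambda>x. u (poly Q x))" and u: "poisson_sub u" and deg: "degree Q > 0"
    and R: "0 < R" "R < S" and r: "r > 0"
    and large: "\<And>x. norm x \<ge> r \<Longrightarrow> norm (poly Q x) \<ge> S"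
  shows "real (degree Q) * cmean u R \<le> (\<Sum>z\<in>#proots Q. poisson r (\<lambda>x. u (poly Q x)) z)"
proof -
  let ?v = "\<lambda>x. u (poly Q x)"
  let ?k = "\<lambda>w y. Re (2 * y * poly (pderiv Q) y / (poly Q y - w) - of_nat (degree Q))"
  have cu: "continuous_on A u" for A using u by (rule poisson_sub_continuous)
  have cv: "continuous_on A ?v" for A using v by (rule poisson_sub_continuous)
  have ne: "poly Q y \<noteq> w" if "norm y = r" "norm w < S" for y w using large[of y] that by auto
  have P0: "Q - [:w:] \<noteq> 0" for w using deg by auto
  \<comment> \<open>All preimages of \<open>w\<close> lie in the disc, as outside it the values of
    \<open>Q\<close> have norm at least \<open>S\<close>.\<close>
  have small: "norm z < r" if "norm w < S" "z \<in># proots (Q - [:w:])" for w z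
    using that large[of z] P0[of w] by (auto simp: not_le[symmetric])
  have sum_eq: "(\<Sum>z\<in>#proots (Q - [:w:]). poisson r ?v z) = cmean (\<lambda>y. ?k w y * ?v y) r" if "norm w < S" for w
  proof -
    have "(\<Sum>z\<in>#proots (Q - [:w:]). poisson r ?v z) = cmean (\<lambda>y. (\<Sum>z\<in>#proots (Q - [:w:]). pker z y) * ?v y) r"
      using sum_mset_poisson[OF small[OF that] cv] r by simp
    also have "\<dots> = cmean (\<lambda>y. ?k w y * ?v y) r"
      by (rule cmean_cong) (use r in \<open>auto simp: sum_pker_proots[OF ne[OF _ that] deg]\<close>)
    finally show ?thesis .
  qed
  have ck: "continuous_on (sphere 0 R \<times> sphere 0 r) (\<lambda>(x, y). ?k x y)"
    unfolding case_prod_unfold by (intro continuous_intros) (use ne R in force)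
  have ckv: "continuous_on (sphere 0 R \<times> sphere 0 r) (\<lambda>(x, y). ?k x y * ?v y)"
  proof -
    have "continuous_on (sphere 0 R \<times> sphere 0 r) (\<lambda>p. ?v (snd p))"
      by (rule continuous_on_compose2[OF cv[of UNIV]]) (auto intro: continuous_intros)
    from continuous_on_mult[OF ck this] show ?thesis by (simp only: case_prod_unfold)
  qed
  \<comment> \<open>Sum \<open>u (poly Q z) <= poisson r ?v z\<close> over the preimages
    \<open>z\<close> of \<open>w\<close>, of which there are \<open>degree Q\<close> with
    multiplicity.\<close>
  have le: "real (degree Q) * u w \<le> cmean (\<lambda>y. ?k w y * ?v y) r" if w: "norm w = R" for w
  proof -
    have "degree (Q - [:w:]) = degree Q"
      using deg by (rule degree_diff_const)
    hence "real (degree Q) * u w = (\<Sum>z\<in>#proots (Q - [:w:]). u w)"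
      using size_proots_complex[of "Q - [:w:]"] by simp
    also have "\<dots> \<le> (\<Sum>z\<in>#proots (Q - [:w:]). poisson r ?v z)"
    proof (rule sum_mset_mono)
      fix z assume z: "z \<in># proots (Q - [:w:])"
      hence "poly Q z = w" using P0 by simp
      with poisson_subD[OF v small[OF _ z]] w R show "u w \<le> poisson r ?v z" by auto
    qed
    also have "\<dots> = cmean (\<lambda>y. ?k w y * ?v y) r" by (rule sum_eq) (use w R in auto)
    finally show ?thesis .
  qed
  have "real (degree Q) * cmean u R = cmean (\<lambda>w. real (degree Q) * u w) R" by (rule cmean_cmult[symmetric])
  also have "\<dots> \<le> cmean (\<lambda>w. cmean (\<lambda>y. ?k w y * ?v y) r) R"
    by (rule cmean_mono) (use le R r ckv cu in \<open>auto intro!: continuous_on_cmean continuous_intros\<close>)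
  also have "\<dots> = cmean (\<lambda>w. 1 * cmean (\<lambda>y. ?k w y * ?v y) r) R" by simp
  also have "\<dots> = cmean (\<lambda>y. cmean (\<lambda>w. 1 * ?k w y) R * ?v y) r"
    by (rule cmean_kernel_swap) (use cv ck R r in auto)
  also have "\<dots> = cmean (\<lambda>y. ?k 0 y * ?v y) r"
  proof (rule cmean_cong)
    fix y assume y: "norm (y::complex) = r"
    have "cmean (\<lambda>w. ?k w y) R = ?k 0 y"
      by (rule cmean_Re_holomorphic[where S = S]) (use R ne[OF y] in \<open>force intro!: holomorphic_intros\<close>)+
    thus "cmean (\<lambda>w. 1 * ?k w y) R * ?v y = ?k 0 y * ?v y" by simp
  qed (use r in auto)
  also have "\<dots> = (\<Sum>z\<in>#proots Q. poisson r ?v z)"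
    using sum_eq[of 0] R by simp
  finally show ?thesis .
qed

section \<open>Jensen's formula and the characteristic of a quotient of entire functions\<close>

text \<open>On a slightly larger disc \<open>q\<close> is still zero-free and has a holomorphic
  logarithm; the mean value property applies to its real part.\<close>

lemma cmean_ln_norm:
  assumes q: "q holomorphic_on UNIV" and nz: "\<And>z. norm z \<le> r \<Longrightarrow> q z \<noteq> 0" and r: "r > 0"
  shows "cmean (\<lambda>z. ln (norm (q z))) r = ln (norm (q 0))"
proof -
  have "open (q -` (- {0}))"
    using holomorphic_on_imp_continuous_on[OF q] by (intro open_vimage) auto
  then obtain e where e: "e > 0" "(\<Union>x\<in>cball 0 r. ball x e) \<subseteq> q -` (- {0})"
  proof (rule compact_subset_open_imp_ball_epsilon_subset[OF compact_cball])
    show "cball 0 r \<subseteq> q -` (- {0})" using nz by auto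
  qed
  have nz': "q z \<noteq> 0" if z: "z \<in> ball 0 (r + e)" for z
  proof (cases "norm z \<le> r")
    case False
    \<comment> \<open>The radial projection of \<open>z\<close> to the circle, closer to
      \<open>z\<close> than \<open>e\<close>.\<close>
    let ?x = "of_real (r / norm z) * z"
    have x: "norm ?x = r" using False r by (auto simp: norm_mult norm_divide)
    have "?x - z = of_real (r / norm z - 1) * z" by (simp add: algebra_simps)
    hence "dist ?x z = \<bar>r / norm z - 1\<bar> * norm z" by (metis dist_norm norm_mult norm_of_real)
    moreover have "norm z > 0" "r / norm z < 1" using False r by (auto simp: not_le divide_less_eq intro: less_trans)
    ultimately have "dist ?x z = norm z - r" by (simp add: left_diff_distrib)
    hence "z \<in> (\<Union>x\<in>cball 0 r. ball x e)" using x z by (intro UN_I[of ?x]) auto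
    thus ?thesis using e(2) by blast
  qed (use nz in auto)
  have "q holomorphic_on ball 0 (r + e)" using q by (rule holomorphic_on_subset) auto
  then obtain g where g: "g holomorphic_on ball 0 (r + e)" "\<And>z. z \<in> ball 0 (r + e) \<Longrightarrow> q z = exp (g z)"
    using contractible_imp_holomorphic_log[of q "ball 0 (r + e)"] nz' convex_imp_contractible[OF convex_ball]
    by metis
  have "cmean (\<lambda>z. ln (norm (q z))) r = cmean (\<lambda>z. Re (g z)) r"
    by (rule cmean_cong) (use g e r in auto)
  also have "\<dots> = Re (g 0)" by (rule cmean_Re_holomorphic[OF g(1)]) (use r e in auto)
  also have "\<dots> = ln (norm (q 0))" using g(2)[of 0] r e by auto
  finally show ?thesis .
qed

text \<open>On the circle, \<open>norm (z - p)\<close> equals the norm of a function whose only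
  possible zero is the reflection of \<open>p\<close>, outside the disc, and whose value at
  \<open>0\<close> is \<open>r\<close>.\<close>

lemma cmean_ln_norm_diff:
  assumes p: "norm p < r"
  shows "cmean (\<lambda>z. ln (norm (z - p))) r = ln r"
proof -
  have r: "r > 0" using p le_less_trans norm_ge_zero by blast
  have eq: "norm (z - p) = norm (of_real r - cnj p * z / of_real r)" if z: "norm z = r" for z
  proof -
    have z0: "z \<noteq> 0" using z r by auto
    have "of_real r * of_real r = z * cnj z"
      using complex_norm_square[of z] z by (simp add: power2_eq_square)
    hence "of_real r - cnj p * z / of_real r = z * cnj (z - p) / of_real r"
      using r by (simp add: field_simps)
    thus ?thesis using z z0 r by (simp add: norm_mult norm_divide flip: complex_cnj_diff)
  qed
  have "cmean (\<lambda>z. ln (norm (z - p))) r = cmean (\<lambda>z. ln (norm (of_real r - cnj p * z / of_real r))) r"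
    by (rule cmean_cong) (use eq r in auto)
  also have "\<dots> = ln (norm (of_real r - cnj p * 0 / of_real r))"
  proof (rule cmean_ln_norm[OF _ _ r])
    fix z :: complex assume z: "norm z \<le> r"
    have "norm (cnj p * z / of_real r) \<le> norm p"
      using z r by (simp add: norm_mult norm_divide field_simps) (metis mult.commute mult_left_mono norm_ge_zero)
    also have "\<dots> < norm (of_real r :: complex)" using p r by simp
    finally show "of_real r - cnj p * z / of_real r \<noteq> 0" by auto
  qed (use r in \<open>auto intro!: holomorphic_intros\<close>)
  finally show ?thesis using r by simp
qed

section \<open>Splitting off zeros of entire functions\<close>

lemma finite_zeros_entire:
  assumes "Q holomorphic_on UNIV" "Q z0 \<noteq> 0"
  shows "finite {z. norm z \<le> r \<and> Q z = 0}"
proof (cases "Q constant_on UNIV")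
  case True
  hence "{z. norm z \<le> r \<and> Q z = 0} = {}" using assms by (auto simp: constant_on_def)
  thus ?thesis by (metis finite.emptyI)
next
  case False
  have "finite {z\<in>cball 0 r. Q z = 0}"
    by (rule holomorphic_compact_finite_zeros[OF assms(1)]) (use False in auto)
  thus ?thesis by simp
qed

text \<open>The local factorization at \<open>p\<close> fills in the quotient there; the ball and
  the punctured plane are open and cover the plane, so the quotient is entire. The case
  \<open>k = 0\<close> is included.\<close>

lemma entire_factor_point:
  assumes H: "H holomorphic_on UNIV" and nz: "H z0 \<noteq> 0"
  shows "\<exists>k q. q holomorphic_on UNIV \<and> q p \<noteq> 0 \<and> (\<forall>z. H z = (z - p) ^ k * q z)"
proof -
  define k g where "k = nat (zorder H p)" and "g = zor_poly H p"
  obtain r where r: "r > 0" "g holomorphic_on cball p r"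
      "\<And>w. w \<in> cball p r \<Longrightarrow> H w = g w * (w - p) ^ k \<and> g w \<noteq> 0"
  proof -
    have "\<exists>r>0. g holomorphic_on cball p r \<and> (\<forall>w\<in>cball p r. H w = g w * (w - p) ^ k \<and> g w \<noteq> 0)"
      using zorder_exist_zero[OF H open_UNIV connected_UNIV, of p] nz unfolding k_def g_def
      by (auto simp: Let_def)
    thus ?thesis using that by blast
  qed
  define q where "q z = (if z = p then g p else H z / (z - p) ^ k)" for z
  have "q holomorphic_on ball p r"
    by (rule holomorphic_transform[of g]) (use r in \<open>auto simp: q_def intro: holomorphic_on_subset\<close>)
  moreover have "q holomorphic_on - {p}"
    by (rule holomorphic_transform[of "\<lambda>z. H z / (z - p) ^ k"])
       (auto simp: q_def intro!: holomorphic_intros holomorphic_on_subset[OF H])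
  ultimately have "q holomorphic_on (ball p r \<union> - {p})"
    by (rule holomorphic_on_Un) auto
  moreover have "ball p r \<union> - {p} = UNIV" using r by auto
  moreover have "H z = (z - p) ^ k * q z" for z
    using r(1) r(3)[of p] by (auto simp: q_def)
  ultimately show ?thesis using r(1) r(3)[of p] by (intro exI[of _ k] exI[of _ q]) (auto simp: q_def)
qed

lemma entire_factor_finite:
  assumes "finite S" and H: "H holomorphic_on UNIV" and nz: "H z0 \<noteq> 0"
  shows "\<exists>k q. q holomorphic_on UNIV \<and> (\<forall>p\<in>S. q p \<noteq> 0) \<and> (\<forall>z. H z = (\<Prod>p\<in>S. (z - p) ^ k p) * q z)"
  using assms(1)
proof (induction S)
  case empty
  show ?case by (intro exI[of _ "\<lambda>_. 0"] exI[of _ H]) (use H in auto)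
next
  case (insert a S)
  then obtain k q where q: "q holomorphic_on UNIV" "\<And>p. p \<in> S \<Longrightarrow> q p \<noteq> 0"
    "\<And>z. H z = (\<Prod>p\<in>S. (z - p) ^ k p) * q z" by blast
  have "q z0 \<noteq> 0" using q(3)[of z0] nz by auto
  then obtain m q' where q': "q' holomorphic_on UNIV" "q' a \<noteq> 0" "\<And>z. q z = (z - a) ^ m * q' z"
    using entire_factor_point[OF q(1)] by blast
  have *: "(\<Prod>p\<in>S. (z - p) ^ (k(a := m)) p) = (\<Prod>p\<in>S. (z - p) ^ k p)" for z
    by (rule prod.cong) (use insert in auto)
  show ?case
  proof (intro exI[of _ "k(a := m)"] exI[of _ q'] conjI ballI allI)
    fix p assume "p \<in> insert a S"
    thus "q' p \<noteq> 0" using q'(2,3) q(2) by (metis insertE mult_zero_right)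
  next
    fix z show "H z = (\<Prod>p\<in>insert a S. (z - p) ^ (k(a := m)) p) * q' z"
      unfolding prod.insert[OF insert(1,2)] * q(3)[of z] q'(3)[of z] by (simp add: mult_ac)
  qed (rule q')
qed

section \<open>Poles and their orders\<close>

text \<open>\<open>zorder\<close> makes the order unique, which the \<open>THE\<close> in
  \<open>pole_order\<close> relies on.\<close>

lemma pole_of_order_imp_zorder:
  assumes "pole_of_order f p k"
  shows "zorder f p = - int k"
proof -
  obtain g r where "r > 0" "g holomorphic_on ball p r" "g p \<noteq> 0"
      "\<And>z. z \<in> ball p r - {p} \<Longrightarrow> f z = g z / (z - p) ^ k"
    using assms unfolding pole_of_order_def by blast
  thus ?thesis
    by (intro zorder_eqI[of "ball p r" p g]) (auto simp: power_int_minus field_simps)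
qed

lemma pole_of_order_imp_is_pole:
  assumes "pole_of_order f p k"
  shows "is_pole f p"
proof -
  obtain g r where r: "r > 0" and g: "g holomorphic_on ball p r" "g p \<noteq> 0"
      and f: "\<And>z. z \<in> ball p r - {p} \<Longrightarrow> f z = g z / (z - p) ^ k" and k: "k > 0"
    using assms unfolding pole_of_order_def by blast
  have "isCont g p"
    using holomorphic_on_imp_continuous_on[OF g(1)] r by (simp add: continuous_on_eq_continuous_at)
  hence "is_pole (\<lambda>z. g z / (z - p) ^ k) p"
    using k g(2) by (intro is_pole_divide filterlim_at_withinI) (auto simp: eventually_at_filter intro!: tendsto_eq_intros)
  moreover have "eventually (\<lambda>z. g z / (z - p) ^ k = f z) (at p)"
    using f r by (auto simp: eventually_at dist_commute intro!: exI[of _ r])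
  ultimately show ?thesis using is_pole_cong[OF _ refl] by metis
qed

lemma pole_order_eqI:
  assumes "pole_of_order f p k"
  shows "pole_order f p = k"
proof -
  have "(THE k. pole_of_order f p k) = k"
    using assms pole_of_order_imp_zorder[of f p] by (intro the_equality) (assumption, metis neg_equal_iff_equal of_nat_eq_iff)
  thus ?thesis using assms by (auto simp: pole_order_def is_pole_pt_def)
qed

section \<open>The characteristic of a quotient of entire functions\<close>

text \<open>\<open>F\<close> is left free at the zeros of \<open>H\<close>, just as
  \<open>meromorphic_C\<close> leaves the values at poles free.\<close>

locale entire_quotient =
  fixes G H F :: "complex \<Rightarrow> complex"
  assumes G: "G holomorphic_on UNIV" and H: "H holomorphic_on UNIV"
    and no_common: "\<And>z. G z \<noteq> 0 \<or> H z \<noteq> 0"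
    and H_nonzero: "\<exists>z. H z \<noteq> 0"
    and F_eq: "\<And>z. H z \<noteq> 0 \<Longrightarrow> F z = G z / H z"
begin

text \<open>The logarithm of the maximum norm of the pair \<open>(G, H)\<close>; its circle means
  give Cartan's form of the characteristic.\<close>

definition U :: "complex \<Rightarrow> real" where
  "U z = ln (max (norm (G z)) (norm (H z)))"

lemma poisson_sub_U: "poisson_sub U"
  using poisson_sub_ln_max[OF G H no_common] unfolding U_def [abs_def] .

lemma countable_zeros: "countable {z. H z = 0}"
proof (cases "H constant_on UNIV")
  case True
  hence "{z. H z = 0} = {}" using H_nonzero by (auto simp: constant_on_def)
  thus ?thesis by (metis countable_empty)
next
  case False
  have "fsigma (UNIV :: complex set)" by simp
  from holomorphic_countable_zeros[OF H open_UNIV connected_UNIV this False] show ?thesis by simp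
qed

lemma not_pole:
  assumes "H p \<noteq> 0"
  shows "\<not> is_pole_pt F p"
proof
  assume "is_pole_pt F p"
  hence "is_pole F p" using pole_of_order_imp_is_pole by (auto simp: is_pole_pt_def)
  moreover have "F \<midarrow>p\<rightarrow> G p / H p"
  proof (rule Lim_transform_eventually)
    have c: "isCont G p" "isCont H p"
      using G H by (auto intro: continuous_on_interior holomorphic_on_imp_continuous_on)
    thus "(\<lambda>z. G z / H z) \<midarrow>p\<rightarrow> G p / H p"
      using assms by (intro tendsto_intros) (auto simp: isCont_def)
    have "\<forall>\<^sub>F z in at p. H z \<noteq> 0"
      using c(2) assms by (intro tendsto_imp_eventually_ne) (auto simp: isCont_def)
    thus "\<forall>\<^sub>F z in at p. G z / H z = F z" by eventually_elim (simp add: F_eq)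
  qed
  ultimately show False
    unfolding is_pole_def using not_tendsto_and_filterlim_at_infinity[of "at p" F "G p / H p"] by simp
qed

text \<open>Where \<open>H\<close> vanishes, \<open>G\<close> does not, so nothing cancels and the
  zero of \<open>H\<close> becomes a pole of the same order.\<close>

lemma pole_order_eq:
  assumes q: "q holomorphic_on UNIV" "q p \<noteq> 0" and Hq: "\<And>z. H z = (z - p) ^ k * q z"
  shows "pole_order F p = k" and "is_pole_pt F p \<longleftrightarrow> k > 0"
proof -
  have pole: "pole_of_order F p k" if k: "k > 0"
  proof -
    have "open (q -` (- {0}))"
      using holomorphic_on_imp_continuous_on[OF q(1)] by (intro open_vimage) auto
    then obtain r where r: "r > 0" "ball p r \<subseteq> q -` (- {0})"
      using q(2) openE[of "q -` (- {0})" p] by auto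
    have Gp: "G p \<noteq> 0" using no_common[of p] Hq[of p] k by auto
    show ?thesis unfolding pole_of_order_def
    proof (intro conjI k exI[of _ "\<lambda>z. G z / q z"] exI[of _ r] ballI r(1))
      show "(\<lambda>z. G z / q z) holomorphic_on ball p r"
        using r by (intro holomorphic_intros holomorphic_on_subset[OF G] holomorphic_on_subset[OF q(1)]) auto
      show "G p / q p \<noteq> 0" using Gp q by auto
      fix z assume z: "z \<in> ball p r - {p}"
      hence "q z \<noteq> 0" using r by auto
      hence "H z \<noteq> 0" using z Hq by auto
      thus "F z = G z / q z / (z - p) ^ k" by (simp add: F_eq Hq)
    qed
  qed
  have np: "\<not> is_pole_pt F p" if "k = 0" using not_pole[of p] that Hq[of p] q by auto
  show "pole_order F p = k"
    using pole_order_eqI[OF pole] np by (cases "k = 0") (auto simp: pole_order_def)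
  show "is_pole_pt F p \<longleftrightarrow> k > 0"
    using pole np by (auto simp: is_pole_pt_def)
qed

text \<open>Dividing the maximum in \<open>U\<close> by \<open>norm (H z)\<close> turns it into
  \<open>max (norm (F z)) 1\<close>, whose logarithm is \<open>logplus (norm (F z))\<close>.\<close>

lemma proximity_eq:
  assumes r: "r > 0" and nz: "\<And>z. norm z = r \<Longrightarrow> H z \<noteq> 0"
  shows "proximity r F = cmean U r - cmean (\<lambda>z. ln (norm (H z))) r"
proof -
  have cU: "continuous_on (sphere 0 r) U" using poisson_sub_U by (rule poisson_sub_continuous)
  have cH: "continuous_on (sphere 0 r) (\<lambda>z. ln (norm (H z)))"
    by (intro continuous_intros continuous_on_subset[OF holomorphic_on_imp_continuous_on[OF H]])
       (use nz in auto)
  let ?d = "\<lambda>z. U z - ln (norm (H z))"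
  have cd: "continuous_on (sphere 0 r) ?d" by (intro continuous_intros cU cH)
  have eq: "logplus (norm (F z)) = ?d z" if "norm z = r" for z
  proof -
    have h: "H z \<noteq> 0" using nz that by auto
    have "?d z = ln (max (norm (G z)) (norm (H z)) / norm (H z))"
      using h unfolding U_def by (subst ln_div) (auto simp: less_max_iff_disj max_def)
    also have "max (norm (G z)) (norm (H z)) / norm (H z) = max (norm (F z)) 1"
      using h by (simp add: max_def F_eq norm_divide field_simps)
    finally show ?thesis by (auto simp: logplus_def max_def)
  qed
  have "(\<integral>\<theta>\<in>{0..2*pi}. logplus (cmod (F (complex_of_real r * cis \<theta>))) \<partial>lborel)
      = (\<integral>\<theta>\<in>{0..2*pi}. ?d (of_real r * cis \<theta>) \<partial>lborel)"
    by (rule set_lebesgue_integral_cong) (use eq r in \<open>auto simp: norm_mult\<close>)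
  also have "\<dots> = integral {0..2*pi} (\<lambda>\<theta>. ?d (of_real r * cis \<theta>))"
    by (rule set_borel_integral_eq_integral(2), rule borel_integrable_atLeastAtMost')
       (rule continuous_on_circle[OF cd], use r in auto)
  finally have "proximity r F = cmean ?d r" by (simp add: proximity_def cmean_def)
  also have "\<dots> = cmean U r - cmean (\<lambda>z. ln (norm (H z))) r"
    by (rule cmean_diff[OF cU cH]) (use r in auto)
  finally show ?thesis .
qed

text \<open>The radii in the countable set \<open>N\<close> are those of circles through a pole; Jensen's formula holds
  there as well, but null sets may be put into the exceptional set.\<close>

lemma nev_T_eq_cmean:
  "\<exists>C N. countable N \<and> (\<forall>r>0. r \<notin> N \<longrightarrow> nev_T r F = cmean U r + C)"
proof -
  \<comment> \<open>The zero at the origin is split off since \<open>integrated_count\<close> treats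
    a pole there separately, by a \<open>ln r\<close> term.\<close>
  obtain k0 H1 where H1: "H1 holomorphic_on UNIV" "H1 0 \<noteq> 0" "\<And>z. H z = z ^ k0 * H1 z"
    using H_nonzero entire_factor_point[OF H, of _ 0] by (metis diff_zero)
  have "nev_T r F = cmean U r - ln (norm (H1 0))" if r: "r > 0" and rN: "r \<notin> norm ` {z. H z = 0}" for r
  proof -
    have nz: "H z \<noteq> 0" if "norm z = r" for z using rN that by auto
    define S where "S = {z. norm z \<le> r \<and> H1 z = 0}"
    have fin: "finite S" unfolding S_def by (rule finite_zeros_entire[OF H1(1,2)])
    obtain k q where q: "q holomorphic_on UNIV" "\<And>p. p \<in> S \<Longrightarrow> q p \<noteq> 0"
        "\<And>z. H1 z = (\<Prod>p\<in>S. (z - p) ^ k p) * q z"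
      using entire_factor_finite[OF fin H1(1,2)] by blast
    have S: "p \<noteq> 0" "norm p < r" if "p \<in> S" for p
      using that H1(2) nz[of p] H1(3)[of p] by (auto simp: S_def less_le)
    have qnz: "q z \<noteq> 0" if "norm z \<le> r" for z
      using q(2)[of z] q(3)[of z] that by (cases "z \<in> S") (auto simp: S_def)
    have cq: "continuous_on A q" for A
      by (rule continuous_on_subset[OF holomorphic_on_imp_continuous_on[OF q(1)]]) auto

    \<comment> \<open>The finitely many zeros inside the circle are pulled out as linear factors;
      \<open>q\<close> is zero-free in the disc, so the mean of every summand is known.\<close>
    have lnH: "ln (norm (H z)) = real k0 * ln r + ((\<Sum>p\<in>S. real (k p) * ln (norm (z - p))) + ln (norm (q z)))"
      if z: "norm z = r" for z
    proof -
      have zp: "z - p \<noteq> 0" if "p \<in> S" for p using S(2)[OF that] z by auto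
      have "norm (H z) = r ^ k0 * ((\<Prod>p\<in>S. norm (z - p) ^ k p) * norm (q z))"
        by (simp add: H1(3) q(3) norm_mult norm_power z prod_norm[symmetric])
      moreover have "(\<Prod>p\<in>S. norm (z - p) ^ k p) > 0"
        by (rule prod_pos) (use zp in auto)
      moreover have "ln (\<Prod>p\<in>S. norm (z - p) ^ k p) = (\<Sum>p\<in>S. real (k p) * ln (norm (z - p)))"
        using zp by (subst ln_prod[OF fin]) (auto simp: ln_realpow)
      moreover have "q z \<noteq> 0" using qnz z by auto
      ultimately show ?thesis using r by (simp add: ln_mult ln_realpow)
    qed
    have "cmean (\<lambda>z. ln (norm (H z))) r
        = cmean (\<lambda>z. real k0 * ln r + ((\<Sum>p\<in>S. real (k p) * ln (norm (z - p))) + ln (norm (q z)))) r"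
      by (rule cmean_cong) (use lnH r in auto)
    also have "\<dots> = real k0 * ln r + ((\<Sum>p\<in>S. cmean (\<lambda>z. real (k p) * ln (norm (z - p))) r) + cmean (\<lambda>z. ln (norm (q z))) r)"
    proof -
      have c1: "continuous_on (sphere 0 r) (\<lambda>z. real (k p) * ln (norm (z - p)))" if "p \<in> S" for p
        by (intro continuous_intros) (use S(2)[OF that] in auto)
      have c2: "continuous_on (sphere 0 r) (\<lambda>z. ln (norm (q z)))"
        by (intro continuous_intros cq) (use qnz in auto)
      show ?thesis using r c1 c2 fin
        by (simp add: cmean_add cmean_sum continuous_intros)
    qed
    also have "\<dots> = real k0 * ln r + ((\<Sum>p\<in>S. real (k p) * ln r) + ln (norm (q 0)))"
      using S qnz r q(1) by (simp add: cmean_cmult cmean_ln_norm_diff cmean_ln_norm)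
    \<comment> \<open>\<open>q\<close> depends on \<open>r\<close>; expressing \<open>q 0\<close>
      through \<open>H1 0\<close> leaves the same constant \<open>ln (norm (H1 0))\<close> for all
      radii.\<close>
    also have "ln (norm (q 0)) = ln (norm (H1 0)) - (\<Sum>p\<in>S. real (k p) * ln (norm p))"
    proof -
      have "norm (H1 0) = (\<Prod>p\<in>S. norm p ^ k p) * norm (q 0)"
        by (simp add: q(3) norm_mult norm_power prod_norm[symmetric])
      moreover have "(\<Prod>p\<in>S. norm p ^ k p) > 0"
        by (rule prod_pos) (use S in auto)
      moreover have "ln (\<Prod>p\<in>S. norm p ^ k p) = (\<Sum>p\<in>S. real (k p) * ln (norm p))"
        using S by (subst ln_prod[OF fin]) (auto simp: ln_realpow)
      moreover have "q 0 \<noteq> 0" using qnz r by auto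
      ultimately show ?thesis by (simp add: ln_mult)
    qed
    finally have cH: "cmean (\<lambda>z. ln (norm (H z))) r
        = real k0 * ln r + (\<Sum>p\<in>S. real (k p) * (ln r - ln (norm p))) + ln (norm (H1 0))"
      by (simp add: sum_subtractf right_diff_distrib)

    have order0: "pole_order F 0 = k0" "is_pole_pt F 0 \<longleftrightarrow> k0 > 0"
      using pole_order_eq[of H1 0 k0] H1 by auto
    have orderS: "pole_order F p = k p" "is_pole_pt F p" if p: "p \<in> S" for p
    proof -
      let ?q = "\<lambda>z. z ^ k0 * (\<Prod>x\<in>S - {p}. (z - x) ^ k x) * q z"
      have "?q holomorphic_on UNIV" by (intro holomorphic_intros q(1))
      moreover have "?q p \<noteq> 0" using S[OF p] q(2)[OF p] fin by auto
      moreover have "H z = (z - p) ^ k p * ?q z" for z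
        unfolding H1(3)[of z] q(3)[of z] prod.remove[OF fin p] by (simp only: mult_ac)
      ultimately have *: "pole_order F p = k p" "is_pole_pt F p \<longleftrightarrow> k p > 0"
        using pole_order_eq[of ?q p "k p"] by blast+
      show "pole_order F p = k p" by fact
      have "H p = 0" using p H1(3)[of p] by (simp add: S_def)
      hence "k p \<noteq> 0" using \<open>?q p \<noteq> 0\<close> \<open>\<And>z. H z = (z - p) ^ k p * ?q z\<close>
        by (metis mult_1 power_0)
      thus "is_pole_pt F p" using * by simp
    qed
    have count: "pole_count t F = real k0 + (\<Sum>p\<in>S. real (k p) * (if norm p \<le> t then 1 else 0))"
      if t: "0 \<le> t" "t \<le> r" for t
    proof -
      let ?A = "{p\<in>S. norm p \<le> t}"
      \<comment> \<open>The origin is inserted whether or not it is a pole; if it is not, its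
        \<open>pole_order\<close> is \<open>0\<close>, and so is \<open>k0\<close>.\<close>
      have "(\<Sum>p\<in>{p. norm p \<le> t \<and> is_pole_pt F p}. pole_order F p) = (\<Sum>p\<in>insert 0 ?A. pole_order F p)"
      proof (rule sum.mono_neutral_left)
        show "finite (insert 0 ?A)" using fin by simp
        show "{p. norm p \<le> t \<and> is_pole_pt F p} \<subseteq> insert 0 ?A"
          using not_pole t H1(3) by (force simp: S_def)
        show "\<forall>i\<in>insert 0 ?A - {p. norm p \<le> t \<and> is_pole_pt F p}. pole_order F i = 0"
          using t by (auto simp: pole_order_def)
      qed
      also have "\<dots> = k0 + (\<Sum>p\<in>?A. k p)"
        using fin S(1) orderS(1) order0 by (subst sum.insert) (auto intro!: sum.cong)
      also have "(\<Sum>p\<in>?A. k p) = (\<Sum>p\<in>S. k p * (if norm p \<le> t then 1 else 0))"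
        by (rule sum.mono_neutral_cong_left) (use fin in auto)
      finally show ?thesis unfolding pole_count_def by (simp add: of_nat_sum if_distrib cong: if_cong)
    qed
    have count0: "pole_count 0 F = real k0"
      using count[of 0] r S(1) by (simp add: sum.neutral)

    \<comment> \<open>A pole \<open>p\<close> is counted for \<open>t >= norm p\<close> and
      contributes the integral of \<open>1 / t\<close> from there to \<open>r\<close>.\<close>
    have "has_bochner_integral lborel (\<lambda>t. \<Sum>p\<in>S. real (k p) * ((1 / t) * indicator {norm p..r} t))
        (\<Sum>p\<in>S. real (k p) * (ln r - ln (norm p)))"
    proof (intro has_bochner_integral_sum has_bochner_integral_mult_right)
      fix p assume p: "p \<in> S"
      have p0: "norm p > 0" "norm p \<le> r" using S[OF p] by auto
      have pos: "t > 0" if "norm p \<le> t" for t using p0(1) that by (rule less_le_trans)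
      show "has_bochner_integral lborel (\<lambda>t. (1 / t) * indicator {norm p..r} t) (ln r - ln (norm p))"
        by (rule has_bochner_integral_FTC_Icc_real)
           (use p0 pos in \<open>force intro!: derivative_eq_intros continuous_intros\<close>)+
    qed
    hence "(\<integral>t. (\<Sum>p\<in>S. real (k p) * ((1 / t) * indicator {norm p..r} t)) \<partial>lborel)
        = (\<Sum>p\<in>S. real (k p) * (ln r - ln (norm p)))"
      by (rule has_bochner_integral_integral_eq)
    moreover have "(\<lambda>t. \<Sum>p\<in>S. real (k p) * ((1 / t) * indicator {norm p..r} t))
        = (\<lambda>t. indicator {0<..r} t *\<^sub>R ((pole_count t F - pole_count 0 F) / t))"
    proof
      fix t :: real
      show "(\<Sum>p\<in>S. real (k p) * ((1 / t) * indicator {norm p..r} t))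
          = indicator {0<..r} t *\<^sub>R ((pole_count t F - pole_count 0 F) / t)"
      proof (cases "t \<in> {0<..r}")
        case True
        hence "pole_count t F - pole_count 0 F = (\<Sum>p\<in>S. real (k p) * (if norm p \<le> t then 1 else 0))"
          using count[of t] count0 by simp
        thus ?thesis using True
          by (simp add: sum_divide_distrib) (intro sum.cong, auto simp: indicator_def)
      next
        case False
        have "indicator {norm p..r} t = (0::real)" if "p \<in> S" for p
        proof -
          have "0 < norm p" using S(1)[OF that] by simp
          thus ?thesis using False by (simp add: indicator_def del: zero_less_norm_iff)
        qed
        thus ?thesis using False by simp
      qed
    qed
    ultimately have "integrated_count r F = (\<Sum>p\<in>S. real (k p) * (ln r - ln (norm p))) + real k0 * ln r"
      unfolding integrated_count_def set_lebesgue_integral_def count0 by simp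
    thus ?thesis unfolding nev_T_def using proximity_eq[OF r nz] cH by simp
  qed
  moreover have "countable (norm ` {z. H z = 0})" using countable_zeros by (rule countable_image)
  ultimately show ?thesis
    by (intro exI[of _ "- ln (norm (H1 0))"] exI[of _ "norm ` {z. H z = 0}"]) auto
qed

end

section \<open>Growth outside sets of finite logarithmic measure\<close>

text \<open>Abel summation: the partial sums are at most the boundary term, bounded by
  \<open>C\<close>, plus partial sums of a convergent series of nonnegative terms.\<close>

lemma summable_by_parts:
  fixes b Z :: "nat \<Rightarrow> real"
  assumes b: "\<And>j. b j \<ge> 0" and Z: "\<And>j. Z j \<ge> 0" "\<And>j. Z j \<le> Z (Suc j)"
    and bnd: "\<And>j. b j * Z j \<le> C" and sm: "summable (\<lambda>j. (b j - b (Suc j)) * Z (Suc j))"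
    and anti: "\<And>j. b (Suc j) \<le> b j"
  shows "summable (\<lambda>j. b j * (Z (Suc j) - Z j))"
proof (rule summableI_nonneg_bounded)
  fix M
  have "(\<Sum>j<M. b j * (Z (Suc j) - Z j))
      = b M * Z M - b 0 * Z 0 + (\<Sum>j<M. (b j - b (Suc j)) * Z (Suc j))"
    by (induction M) (simp_all add: algebra_simps)
  also have "\<dots> \<le> C - 0 + (\<Sum>j. (b j - b (Suc j)) * Z (Suc j))"
    using b[of 0] Z(1)[of 0] bnd[of M] Z(1) anti
    by (intro add_mono diff_mono sum_le_suminf sm) auto
  finally show "(\<Sum>j<M. b j * (Z (Suc j) - Z j)) \<le> C + (\<Sum>j. (b j - b (Suc j)) * Z (Suc j))" by simp
qed (use b Z in auto)

text \<open>The difference of powers is of order \<open>j powr (d - 2)\<close>, so the terms are of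
  order \<open>j powr (s + d - 2)\<close>, with exponent below \<open>-1\<close>.\<close>

lemma summable_powr_diff:
  assumes "0 < d" "s + d < 1" "0 < s"
  shows "summable (\<lambda>j. (real (j + m) powr (d - 1) - real (Suc j + m) powr (d - 1)) * real (Suc j + m) powr s)"
proof (rule summable_comparison_test_bigo)
  show "summable (\<lambda>j. norm (real j powr (s + d - 2)))"
    using assms by (simp add: summable_real_powr_iff)
  show "(\<lambda>j. (real (j + m) powr (d - 1) - real (Suc j + m) powr (d - 1)) * real (Suc j + m) powr s)
      \<in> O(\<lambda>j. real j powr (s + d - 2))"
    using assms by real_asymp
qed

lemma half_le_ln_one_plus:
  fixes x :: real
  assumes "0 \<le> x" "x \<le> 1"
  shows "x / 2 \<le> ln (1 + x)"
proof -
  have "ln (1 / (1 + x)) \<le> 1 / (1 + x) - 1"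
    using assms by (intro ln_le_minus_one) auto
  hence "1 - 1 / (1 + x) \<le> ln (1 + x)" using assms by (simp add: ln_div)
  moreover have "x / 2 \<le> x / (1 + x)" using assms by (intro divide_left_mono) auto
  moreover have "x / (1 + x) = 1 - 1 / (1 + x)" using assms by (simp add: field_simps)
  ultimately show ?thesis by simp
qed

lemma finite_log_measure_Un_countable:
  assumes E: "finite_log_measure E" and N: "countable N" "N \<subseteq> {1..}"
  shows "finite_log_measure (E \<union> N)"
proof -
  have null: "N \<in> null_sets lborel" using N(1) by (rule countable_imp_null_set_lborel)
  have "(\<integral>\<^sup>+ t. indicator (E \<union> N) t / ennreal t \<partial>lborel) = (\<integral>\<^sup>+ t. indicator E t / ennreal t \<partial>lborel)"
    by (rule nn_integral_cong_AE) (use AE_not_in[OF null] in \<open>eventually_elim, auto simp: indicator_def\<close>)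
  thus ?thesis using E N null unfolding finite_log_measure_def by auto
qed

text \<open>Block \<open>m\<close> has length \<open>K\<close> and starts at \<open>m * K\<close>,
  so its logarithmic measure is at most \<open>1 / m\<close>.\<close>

lemma finite_log_measure_blocks:
  assumes K: "K > 0" and B: "\<And>m. m \<in> B \<Longrightarrow> real m * K \<ge> 1"
    and sm: "summable (\<lambda>m. if m \<in> B then 1 / real m else 0)"
  shows "finite_log_measure (\<Union>m\<in>B. {real m * K..<real (Suc m) * K})"
  unfolding finite_log_measure_def
proof (intro conjI)
  let ?I = "\<lambda>m. {real m * K..<real (Suc m) * K}"
  let ?E = "\<Union>m\<in>B. ?I m"
  let ?c = "\<lambda>m. if m \<in> B then 1 / (real m * K) else 0"
  show "?E \<subseteq> {1..}" using B by force
  show "?E \<in> sets lborel" by (intro sets.countable_UN') auto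
  have "(\<integral>\<^sup>+ t. indicator ?E t / ennreal t \<partial>lborel)
      \<le> (\<integral>\<^sup>+ t. (\<Sum>m. ennreal (?c m) * indicator (?I m) t) \<partial>lborel)"
  proof (rule nn_integral_mono)
    fix t :: real
    show "indicator ?E t / ennreal t \<le> (\<Sum>m. ennreal (?c m) * indicator (?I m) t)"
    proof (cases "t \<in> ?E")
      case True
      then obtain m where m: "m \<in> B" "t \<in> ?I m" by blast
      have mK: "real m * K \<ge> 1" using B m by auto
      have "indicator ?E t / ennreal t = ennreal (1 / t)"
        using True mK m by (simp add: divide_ennreal flip: ennreal_1)
      also have "\<dots> \<le> ennreal (1 / (real m * K))"
        using mK m by (intro ennreal_leI divide_left_mono) auto
      also have "\<dots> = ennreal (?c m) * indicator (?I m) t" using m by simp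
      also have "\<dots> \<le> (\<Sum>m. ennreal (?c m) * indicator (?I m) t)"
        using sum_le_suminf[of "\<lambda>m. ennreal (?c m) * indicator (?I m) t" "{m}"]
        by (simp only: sum.insert sum.empty finite.intros empty_iff not_False_eq_True add_0_right) simp
      finally show ?thesis .
    qed simp
  qed
  also have "\<dots> = (\<Sum>m. \<integral>\<^sup>+ t. ennreal (?c m) * indicator (?I m) t \<partial>lborel)"
    by (rule nn_integral_suminf) auto
  also have "\<dots> = (\<Sum>m. ennreal (if m \<in> B then 1 / real m else 0))"
  proof (rule suminf_cong)
    fix m
    have "(\<integral>\<^sup>+ t. ennreal (?c m) * indicator (?I m) t \<partial>lborel) = ennreal (?c m) * ennreal (real (Suc m) * K - real m * K)"
      using K by (subst nn_integral_cmult_indicator) auto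
    also have "real (Suc m) * K - real m * K = K" by (simp add: algebra_simps)
    also have "ennreal (?c m) * ennreal K = ennreal (if m \<in> B then 1 / real m else 0)"
      using K by (subst ennreal_mult''[symmetric]) auto
    finally show "(\<integral>\<^sup>+ t. ennreal (?c m) * indicator (?I m) t \<partial>lborel) = ennreal (if m \<in> B then 1 / real m else 0)" .
  qed
  also have "\<dots> < \<infinity>"
    using ennreal_suminf_neq_top[OF sm] by (auto simp: less_top)
  finally show "(\<integral>\<^sup>+ t. indicator ?E t / ennreal t \<partial>lborel) < \<infinity>" .
qed

text \<open>On the grid of multiples of \<open>K\<close>, a bad block \<open>m\<close> costs an increase of \<open>ln \<phi>\<close> by at least
  \<open>m\<^sup>-\<^sup>d / 2\<close>; summation by parts against \<open>ln \<phi> = O(m\<^sup>s)\<close> with \<open>s + d < 1\<close> shows that the bad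
  \<open>m\<close> have a finite sum of reciprocals.\<close>

lemma growth_regular_off_finite_log_measure:
  fixes \<phi> :: "real \<Rightarrow> real"
  assumes mono: "\<And>x y. r0 \<le> x \<Longrightarrow> x \<le> y \<Longrightarrow> \<phi> x \<le> \<phi> y"
    and ge1: "\<And>x. r0 \<le> x \<Longrightarrow> \<phi> x \<ge> 1"
    and growth: "\<And>x. r0 \<le> x \<Longrightarrow> ln (\<phi> x) \<le> C * x powr s"
    and s: "0 < s" "s < 1" and K: "K > 0"
  shows "\<exists>E \<eta>. finite_log_measure E \<and> (\<eta> \<longlongrightarrow> 0) at_top \<and>
    (\<forall>\<^sub>F r in at_top. r \<notin> E \<longrightarrow> \<phi> (r + K) \<le> (1 + \<eta> r) * \<phi> (r - K))"
proof -
  \<comment> \<open>This gives \<open>s + d = (1 + s) / 2 < 1\<close>, as the summation by parts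
    demands.\<close>
  define d where "d = (1 - s) / 2"
  have d: "0 < d" "s + d < 1" "d < 1" using s by (auto simp: d_def field_simps)
  \<comment> \<open>The grid starts late enough that even \<open>(m0 - 1) * K\<close> is at least
    \<open>r0\<close> and that all blocks lie in \<open>{1..}\<close>.\<close>
  define m0 where "m0 = nat \<lceil>\<bar>r0\<bar> / K\<rceil> + nat \<lceil>1 / K\<rceil> + 2"
  have m0: "real m0 * K \<ge> 1" "(real m0 - 1) * K \<ge> r0" "m0 \<ge> 2"
  proof -
    have "real m0 \<ge> \<bar>r0\<bar> / K + 1 / K + 2"
      unfolding m0_def of_nat_add by (intro add_mono) (auto simp: of_nat_nat K less_imp_le)
    hence "real m0 * K \<ge> (\<bar>r0\<bar> / K + 1 / K + 2) * K" using K by (intro mult_right_mono) auto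
    hence *: "real m0 * K \<ge> \<bar>r0\<bar> + 1 + 2 * K" using K by (simp add: distrib_right)
    show "real m0 * K \<ge> 1" "(real m0 - 1) * K \<ge> r0" using * K by (auto simp: algebra_simps)
  qed (simp add: m0_def)
  define L where "L m = ln (\<phi> (real m * K))" for m
  have dom: "real m * K \<ge> r0" if "Suc m \<ge> m0" for m
  proof -
    have "(real m0 - 1) * K \<le> real m * K" using that K by (intro mult_right_mono) auto
    thus ?thesis using m0 by simp
  qed
  have L_nonneg: "L m \<ge> 0" if "Suc m \<ge> m0" for m
    using ge1[OF dom[OF that]] by (simp add: L_def)
  have L_mono: "L m \<le> L k" if "Suc m \<ge> m0" "m \<le> k" for m k
    unfolding L_def using ge1[OF dom[OF that(1)]] mono[OF dom[OF that(1)], of "real k * K"] that K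
    by (intro ln_mono) auto
  define e where "e m = real m powr (- d)" for m
  \<comment> \<open>For \<open>r\<close> in block \<open>m\<close>, \<open>r + K\<close> is below
    \<open>(m + 2) * K\<close> and \<open>r - K\<close> is at least \<open>(m - 1) * K\<close>,
    whence the two indices.\<close>
  define B where "B = {m. m \<ge> m0 \<and> ln (1 + e m) < L (m + 2) - L (m - 1)}"
  \<comment> \<open>The weight is chosen so that
    \<open>b j * e (j + m0) = 1 / (j + m0)\<close>.\<close>
  define b where "b j = real (j + m0) powr (d - 1)" for j
  \<comment> \<open>Three neighbours, so that \<open>Z (Suc j) - Z j\<close> telescopes to the
    increase of \<open>L\<close> tested in \<open>B\<close> for block \<open>j + m0\<close>.\<close>
  define Z where "Z j = L (j + m0 + 1) + L (j + m0) + L (j + m0 - 1)" for j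
  define C' where "C' = 3 * \<bar>C\<bar> * (2 * K) powr s"
  have C': "C' \<ge> 0" by (simp add: C'_def)
  have Z_bound: "Z j \<le> C' * real (j + m0) powr s" for j
  proof -
    have "L (j + m0 + 1) \<le> C * (real (j + m0 + 1) * K) powr s"
      unfolding L_def by (intro growth dom) auto
    also have "\<dots> \<le> \<bar>C\<bar> * (real (j + m0) * (2 * K)) powr s"
    proof (rule mult_mono)
      have "real (j + m0 + 1) * K \<le> (2 * real (j + m0)) * K"
        using m0 K by (intro mult_right_mono) auto
      thus "(real (j + m0 + 1) * K) powr s \<le> (real (j + m0) * (2 * K)) powr s"
        using s K by (intro powr_mono2) (auto simp: mult_ac)
    qed auto
    also have "\<dots> = \<bar>C\<bar> * (2 * K) powr s * real (j + m0) powr s"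
      using K by (subst powr_mult) (simp_all add: mult_ac)
    finally have "L (j + m0 + 1) \<le> \<bar>C\<bar> * (2 * K) powr s * real (j + m0) powr s" .
    moreover have "L (j + m0) \<le> L (j + m0 + 1)" "L (j + m0 - 1) \<le> L (j + m0 + 1)"
      using m0 by (auto intro!: L_mono)
    ultimately show ?thesis unfolding Z_def C'_def by simp
  qed
  have Z_nonneg: "Z j \<ge> 0" for j
    using L_nonneg[of "j + m0 + 1"] L_nonneg[of "j + m0"] L_nonneg[of "j + m0 - 1"] m0 by (simp add: Z_def)
  have Z_diff: "Z (Suc j) - Z j = L (j + m0 + 2) - L (j + m0 - 1)" for j
    using m0 by (simp add: Z_def)
  have b_anti: "b (Suc j) \<le> b j" for j
    unfolding b_def using d m0 by (intro powr_mono2') auto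
  have sm: "summable (\<lambda>j. b j * (Z (Suc j) - Z j))"
  proof (rule summable_by_parts)
    show "b j \<ge> 0" for j by (simp add: b_def)
    show "Z j \<le> Z (Suc j)" for j
    proof -
      have "L (j + m0 - 1) \<le> L (j + m0 + 2)" by (rule L_mono) auto
      thus ?thesis using Z_diff[of j] by simp
    qed
    show "b j * Z j \<le> C'" for j
    proof -
      have "b j * Z j \<le> b j * (C' * real (j + m0) powr s)"
        by (intro mult_left_mono Z_bound) (simp add: b_def)
      also have "\<dots> = C' * real (j + m0) powr (s + d - 1)"
        by (simp add: b_def algebra_simps flip: powr_add)
      also have "\<dots> \<le> C' * real (j + m0) powr 0"
        using d m0 C' by (intro mult_left_mono powr_mono) auto
      also have "\<dots> = C'" using m0 by simp
      finally show ?thesis .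
    qed
    have "summable (\<lambda>j. C' * ((real (j + m0) powr (d - 1) - real (Suc j + m0) powr (d - 1)) * real (Suc j + m0) powr s))"
      by (intro summable_mult summable_powr_diff) (use s d in auto)
    thus "summable (\<lambda>j. (b j - b (Suc j)) * Z (Suc j))"
    proof (rule summable_comparison_test'[where N = 0])
      fix j :: nat
      have "(b j - b (Suc j)) * Z (Suc j) \<le> (b j - b (Suc j)) * (C' * real (Suc j + m0) powr s)"
        using b_anti Z_bound[of "Suc j"] by (intro mult_left_mono) auto
      thus "norm ((b j - b (Suc j)) * Z (Suc j)) \<le> C' * ((real (j + m0) powr (d - 1) - real (Suc j + m0) powr (d - 1)) * real (Suc j + m0) powr s)"
        using b_anti[of j] Z_nonneg[of "Suc j"] by (simp add: b_def mult_ac)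
    qed
  qed (use Z_nonneg b_anti in auto)
  let ?E = "\<Union>m\<in>B. {real m * K..<real (Suc m) * K}"
  have "finite_log_measure ?E"
  proof (rule finite_log_measure_blocks[OF K])
    fix m assume "m \<in> B"
    hence "real m0 * K \<le> real m * K" using K by (intro mult_right_mono) (auto simp: B_def)
    thus "1 \<le> real m * K" using m0 by simp
  next
    have "summable (\<lambda>j. if j + m0 \<in> B then 1 / real (j + m0) else 0)"
    proof (rule summable_comparison_test'[where N = 0])
      show "summable (\<lambda>j. 2 * (b j * (Z (Suc j) - Z j)))" by (intro summable_mult sm)
      fix j :: nat
      let ?m = "j + m0"
      have m: "real ?m \<ge> 1" using m0 by simp
      have e1: "0 \<le> e ?m" "e ?m \<le> 1"
        using powr_mono[of "-d" 0 "real ?m"] m d by (auto simp: e_def)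
      have nn: "b j * (Z (Suc j) - Z j) \<ge> 0"
        unfolding Z_diff b_def using L_mono[of "?m - 1" "?m + 2"] by simp
      show "norm (if ?m \<in> B then 1 / real ?m else 0) \<le> 2 * (b j * (Z (Suc j) - Z j))"
      proof (cases "?m \<in> B")
        case True
        have "e ?m / 2 \<le> Z (Suc j) - Z j"
          using half_le_ln_one_plus[OF e1] True unfolding Z_diff B_def by simp
        hence "b j * (e ?m / 2) \<le> b j * (Z (Suc j) - Z j)"
          by (intro mult_left_mono) (auto simp: b_def)
        moreover have "b j * e ?m = real ?m powr (-1)"
          by (simp add: b_def e_def flip: powr_add)
        moreover have "\<dots> = 1 / real ?m" using m by (simp add: powr_minus_divide)
        ultimately have "1 / real ?m \<le> 2 * (b j * (Z (Suc j) - Z j))" by linarith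
        thus ?thesis using True by simp
      qed (use nn in simp)
    qed
    thus "summable (\<lambda>m. if m \<in> B then 1 / real m else 0)"
      by (subst (asm) summable_iff_shift)
  qed
  \<comment> \<open>As \<open>m > r / K - 1\<close> for the block \<open>m\<close> containing
    \<open>r\<close>, this function bounds \<open>e m\<close>.\<close>
  moreover have "((\<lambda>r. (r / K - 1) powr (- d)) \<longlongrightarrow> 0) at_top"
    using K d by real_asymp
  moreover have "\<forall>\<^sub>F r in at_top. r \<notin> ?E \<longrightarrow> \<phi> (r + K) \<le> (1 + (r / K - 1) powr (- d)) * \<phi> (r - K)"
    using eventually_gt_at_top[of "(real m0 + 2) * K"]
  proof eventually_elim
    case (elim r)
    show ?case
    proof
      assume rE: "r \<notin> ?E"
      define m where "m = nat \<lfloor>r / K\<rfloor>"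
      have rK: "r / K > real m0 + 2" using elim K by (simp add: field_simps)
      have mr: "real m \<le> r / K" "r / K < real m + 1"
        unfolding m_def using rK by (auto simp: of_nat_nat)
      hence mr': "real m * K \<le> r" "r < (real m + 1) * K" using K by (auto simp: field_simps)
      have mm0: "m \<ge> m0" using mr rK by linarith
      have "m \<notin> B" using rE mr' by (auto simp: algebra_simps)
      hence le: "L (m + 2) \<le> ln (1 + e m) + L (m - 1)" using mm0 by (auto simp: B_def)
      have pos: "\<phi> (real k * K) > 0" if "Suc k \<ge> m0" for k using ge1[OF dom[OF that]] by simp
      have r1: "(real m - 1) * K \<ge> r0" using dom[of "m - 1"] mm0 m0 by (simp add: of_nat_diff)
      have "\<phi> (r + K) \<le> \<phi> (real (m + 2) * K)"
        using mr' r1 K by (intro mono) (auto simp: algebra_simps)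
      also have "\<dots> = exp (L (m + 2))" unfolding L_def using pos[of "m + 2"] mm0 by simp
      also have "\<dots> \<le> exp (ln (1 + e m) + L (m - 1))" using le by simp
      also have "\<dots> = (1 + e m) * \<phi> (real (m - 1) * K)"
        unfolding L_def exp_add using pos[of "m - 1"] mm0 m0 by (simp add: e_def add_pos_nonneg)
      also have "\<dots> \<le> (1 + (r / K - 1) powr (- d)) * \<phi> (r - K)"
      proof (intro mult_mono add_left_mono)
        show "e m \<le> (r / K - 1) powr (- d)"
          unfolding e_def using mr rK d by (intro powr_mono2') auto
        show "\<phi> (real (m - 1) * K) \<le> \<phi> (r - K)"
          using mr' r1 mm0 m0 by (intro mono) (auto simp: of_nat_diff algebra_simps)
        show "\<phi> (real (m - 1) * K) \<ge> 0" using pos[of "m - 1"] mm0 m0 by simp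
      qed auto
      finally show "\<phi> (r + K) \<le> (1 + (r / K - 1) powr (- d)) * \<phi> (r - K)" .
    qed
  qed
  ultimately show ?thesis by blast
qed

section \<open>Meromorphic functions as quotients of entire functions\<close>

text \<open>Weierstrass factorization is applied to \<open>remove_sings f\<close>, since the values
  of \<open>f\<close> at its poles are arbitrary.\<close>

lemma meromorphic_C_quotient:
  assumes "meromorphic_C f"
  shows "\<exists>G H. entire_quotient G H f"
proof -
  obtain P where P: "\<And>z. \<not> z islimpt P" "f holomorphic_on (UNIV - P)" "\<And>p. p \<in> P \<Longrightarrow> is_pole_pt f p"
    using assms unfolding meromorphic_C_def by blast
  have "closed P" using P(1) by (simp add: closed_limpt)
  hence op: "open (UNIV - P)" by auto
  have an: "f analytic_on {z}" if "z \<notin> P" for z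
    using P(2) op that analytic_at[of f z] by blast
  have "f meromorphic_on {z}" for z
  proof (cases "z \<in> P")
    case True
    then obtain k where k: "pole_of_order f z k" using P(3) by (auto simp: is_pole_pt_def)
    then obtain g r where r: "r > 0" and g: "g holomorphic_on ball z r"
      and f: "\<And>w. w \<in> ball z r - {z} \<Longrightarrow> f w = g w / (w - z) ^ k"
      unfolding pole_of_order_def by blast
    have "g analytic_on {z}" using g r analytic_at[of g z] by (meson centre_in_ball open_ball)
    hence "(\<lambda>w. g w / (w - z) ^ k) meromorphic_on {z}"
      by (intro meromorphic_intros analytic_on_imp_meromorphic_on) (auto intro!: analytic_intros)
    moreover have "eventually (\<lambda>w. g w / (w - z) ^ k = f w) (at z)"
      using f r by (auto simp: eventually_at dist_commute intro!: exI[of _ r])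
    ultimately show ?thesis using meromorphic_on_cong[of "{z}" "\<lambda>w. g w / (w - z) ^ k" f "{z}"] by simp
  qed (use an analytic_on_imp_meromorphic_on in blast)
  hence mero: "f meromorphic_on UNIV" by (metis UNIV_I meromorphic_on_def singletonI)
  obtain h f1 f2 where hf:
    "h holomorphic_on UNIV" "f1 holomorphic_on UNIV" "f2 holomorphic_on UNIV"
    "\<And>z. f1 z = 0 \<longleftrightarrow> \<not>is_pole (remove_sings f) z \<and> remove_sings f z = 0"
    "\<And>z. f2 z = 0 \<longleftrightarrow> is_pole (remove_sings f) z"
    "\<And>z. h z \<noteq> 0"
    "\<And>z. remove_sings f z = h z * f1 z / f2 z"
    using weierstrass_factorization_meromorphic_UNIV[OF remove_sings_nicely_meromorphic[OF mero]] by metis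
  \<comment> \<open>With the zeros of \<open>f2\<close> being exactly \<open>P\<close>,
    \<open>f\<close> is analytic wherever \<open>f2\<close> is nonzero and equals
    \<open>remove_sings f\<close> there.\<close>
  have f2: "f2 z = 0 \<longleftrightarrow> z \<in> P" for z
  proof (cases "z \<in> P")
    case True
    hence "is_pole f z" using P(3) pole_of_order_imp_is_pole by (auto simp: is_pole_pt_def)
    moreover have "isolated_singularity_at f z"
      using mero meromorphic_on_isolated_singularity meromorphic_on_subset by blast
    ultimately show ?thesis using True hf(5) by simp
  next
    case False
    have "isCont f z" using an[OF False] analytic_at_imp_isCont by blast
    hence "\<not> is_pole f z" unfolding is_pole_def isCont_def
      using not_tendsto_and_filterlim_at_infinity[of "at z" f "f z"] by auto
    moreover have "isolated_singularity_at f z"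
      using mero meromorphic_on_isolated_singularity meromorphic_on_subset by blast
    ultimately show ?thesis using False hf(5) by simp
  qed
  have "entire_quotient (\<lambda>z. h z * f1 z) f2 f"
  proof
    show "(\<lambda>z. h z * f1 z) holomorphic_on UNIV" by (intro holomorphic_intros hf)
    show "h z * f1 z \<noteq> 0 \<or> f2 z \<noteq> 0" for z using hf by auto
    show "\<exists>z. f2 z \<noteq> 0"
    proof (rule ccontr)
      assume "\<not> (\<exists>z. f2 z \<noteq> 0)"
      hence "P = UNIV" using f2 by auto
      thus False using P(1)[of 0] islimpt_UNIV by metis
    qed
    show "f z = h z * f1 z / f2 z" if "f2 z \<noteq> 0" for z
      using hf(7)[of z] an[of z] f2[of z] that remove_sings_at_analytic[of f z] by simp
  qed (rule hf)
  thus ?thesis by blast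
qed

lemma poisson_sum_mset_le_cmean:
  assumes v: "poisson_sub v" and d: "d > 0"
  shows "\<exists>C R0. \<forall>R>R0. (\<Sum>z\<in>#M. poisson R v z) \<le> real (size M) * ((1 + d) * cmean v R) + C"
proof (induction M)
  case empty
  show ?case by (intro exI[of _ 0]) simp
next
  case (add z M)
  then obtain C R0 where 1: "\<And>R. R > R0 \<Longrightarrow> (\<Sum>z\<in>#M. poisson R v z) \<le> real (size M) * ((1 + d) * cmean v R) + C"
    by blast
  obtain C' R0' where 2: "\<And>R. R > R0' \<Longrightarrow> poisson R v z \<le> (1 + d) * cmean v R + C'"
    using poisson_le_cmean_asymp[OF v d] by blast
  have "(\<Sum>z\<in>#add_mset z M. poisson R v z) \<le> real (size (add_mset z M)) * ((1 + d) * cmean v R) + (C + C')"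
    if "R > max R0 R0'" for R
  proof -
    have "(\<Sum>z\<in>#add_mset z M. poisson R v z)
        \<le> ((1 + d) * cmean v R + C') + (real (size M) * ((1 + d) * cmean v R) + C)"
      using 1[of R] 2[of R] that by simp
    also have "\<dots> = real (size (add_mset z M)) * ((1 + d) * cmean v R) + (C + C')"
      by (simp add: distrib_right)
    finally show ?thesis .
  qed
  thus ?case by blast
qed

section \<open>Composition with entire maps and a lower bound for the mean of
  \<open>U\<close>\<close>

context entire_quotient
begin

lemma compose:
  assumes w: "w holomorphic_on UNIV" and surj: "range w = UNIV"
  shows "entire_quotient (G \<circ> w) (H \<circ> w) (F \<circ> w)"
proof
  show "(G \<circ> w) holomorphic_on UNIV" "(H \<circ> w) holomorphic_on UNIV"
    using G H by (auto intro!: holomorphic_on_compose[OF w] intro: holomorphic_on_subset)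
  obtain z where "H z \<noteq> 0" using H_nonzero by blast
  moreover obtain x where "z = w x" using surj by (metis UNIV_I rangeE)
  ultimately show "\<exists>z. (H \<circ> w) z \<noteq> 0" by auto
qed (use F_eq no_common in auto)

lemma norm_combination_le:
  "norm (a * G z + b * H z) \<le> (norm a + norm b) * exp (U z)"
proof -
  have "max (norm (G z)) (norm (H z)) > 0" using no_common[of z] by (auto simp: less_max_iff_disj)
  hence e: "exp (U z) = max (norm (G z)) (norm (H z))" by (simp add: U_def)
  have "norm (a * G z + b * H z) \<le> norm a * norm (G z) + norm b * norm (H z)"
    by (metis norm_mult norm_triangle_ineq)
  also have "\<dots> \<le> norm a * exp (U z) + norm b * exp (U z)"
    unfolding e by (intro add_mono mult_left_mono) auto
  finally show ?thesis by (simp add: distrib_right)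
qed

text \<open>Some combination \<open>D\<close> of \<open>G\<close> and \<open>H\<close> vanishes at a
  point \<open>w\<close> but not at \<open>0\<close>. Dividing out the zero gains a factor of order
  at least \<open>r\<close> on the circle, which the Poisson bound at \<open>0\<close> turns into a
  logarithm.\<close>

lemma cmean_U_lower_bound:
  assumes nonconst: "\<nexists>a. \<forall>z. G z = a * H z"
  shows "\<exists>C r0. \<forall>r>r0. cmean U r \<ge> ln (r - r0) - C"
proof -
  \<comment> \<open>The pairs \<open>(G w, H w)\<close> and \<open>(G 0, H 0)\<close> are not
    proportional; if \<open>H 0 = 0\<close>, any \<open>w\<close> with \<open>H w \<noteq> 0\<close>
    will do.\<close>
  obtain w where w: "H w * G 0 \<noteq> G w * H 0"
  proof (cases "H 0 = 0")
    case True
    thus ?thesis using H_nonzero no_common[of 0] that by fastforce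
  next
    case False
    obtain w where "G w \<noteq> G 0 / H 0 * H w" using nonconst by blast
    thus ?thesis using False by (intro that[of w]) (simp add: field_simps)
  qed
  define D where "D z = H w * G z + (- G w) * H z" for z
  have D: "D holomorphic_on UNIV" unfolding D_def by (intro holomorphic_intros G H)
  have D0: "D 0 \<noteq> 0" using w by (simp add: D_def)
  have Dw: "D w = 0" by (simp add: D_def)
  obtain k q where q: "q holomorphic_on UNIV" "q w \<noteq> 0" "\<And>z. D z = (z - w) ^ k * q z"
    using entire_factor_point[OF D D0, of w] by blast
  have k: "k > 0" using q(2) q(3)[of w] Dw by (cases k) auto
  have q0: "q 0 \<noteq> 0" using q(3)[of 0] D0 by auto
  let ?c = "norm (H w) + norm (- G w)"
  have c: "?c > 0" using no_common[of w] by (auto simp: add_pos_nonneg add_nonneg_pos)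
  \<comment> \<open>The extra \<open>1\<close> gives \<open>norm (z - w) > 1\<close> on the circle,
    so the power with exponent \<open>k\<close> is at least its base.\<close>
  have "cmean U r \<ge> ln (r - (norm w + 1)) - (ln ?c - ln (norm (q 0)))" if r: "r > norm w + 1" for r
  proof -
    have rw: "r - norm w > 1" "r - (norm w + 1) > 0" using r by auto
    have r0: "r > 0" using rw by (smt (verit) norm_ge_zero)
    have cU: "continuous_on A U" for A using poisson_sub_U by (rule poisson_sub_continuous)
    let ?u = "\<lambda>z. U z + (ln ?c - ln (r - (norm w + 1)))"
    have "norm (q 0) \<le> exp (poisson r ?u 0)"
    proof (rule norm_le_exp_poisson[OF q(1)])
      fix z :: complex assume z: "norm z = r"
      have zw: "norm (z - w) \<ge> r - norm w" using norm_triangle_ineq2[of z w] z by simp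
      have "norm (z - w) ^ 1 \<le> norm (z - w) ^ k"
        using zw rw k by (intro power_increasing) auto
      hence zwk: "r - (norm w + 1) \<le> norm (z - w) ^ k" using zw by simp
      have "(r - (norm w + 1)) * norm (q z) \<le> norm (z - w) ^ k * norm (q z)"
        using zwk by (intro mult_right_mono) auto
      also have "\<dots> = norm (D z)" by (simp add: q(3) norm_mult norm_power)
      also have "\<dots> \<le> ?c * exp (U z)" unfolding D_def by (rule norm_combination_le)
      finally have "norm (q z) \<le> exp (U z) * ?c / (r - (norm w + 1))"
        using rw by (simp add: field_simps)
      also have "\<dots> = exp (?u z)"
        using c rw by (simp add: exp_add exp_diff)
      finally show "norm (q z) \<le> exp (?u z)" .
    qed (use r0 in \<open>auto intro!: continuous_intros cU\<close>)
    also have "poisson r ?u 0 = cmean U r + (ln ?c - ln (r - (norm w + 1)))"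
      using r0 cU by (simp add: poisson_0 cmean_add)
    finally have "ln (norm (q 0)) \<le> cmean U r + (ln ?c - ln (r - (norm w + 1)))"
      using q0 by (metis ln_exp ln_mono zero_less_norm_iff)
    thus ?thesis by simp
  qed
  thus ?thesis by blast
qed

end

section \<open>The comparison\<close>

text \<open>For good radii \<open>\<phi>\<close> varies by at most a factor \<open>1 + d\<close>
  between \<open>r - K\<close> and \<open>r + K\<close>, so the upper and lower bounds for
  \<open>B\<close> close up; \<open>\<phi>\<close> tends to infinity and absorbs all additive
  constants.\<close>

lemma eventually_ratio_near_1:
  fixes \<phi> B \<eta> :: "real \<Rightarrow> real"
  assumes top: "filterlim \<phi> at_top at_top"
    and mono: "\<forall>\<^sub>F r in at_top. \<phi> (r - K) \<le> \<phi> r \<and> \<phi> r \<le> \<phi> (r + K)"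
    and upper: "\<And>d. d > 0 \<Longrightarrow> \<exists>C. \<forall>\<^sub>F r in at_top. B r \<le> (1 + d) * \<phi> (r + K) + C"
    and lower: "\<And>d. d > 0 \<Longrightarrow> \<exists>C. \<forall>\<^sub>F r in at_top. \<phi> (r - K) \<le> (1 + d) * B r + C"
    and \<eta>: "(\<eta> \<longlongrightarrow> 0) at_top"
    and growth: "\<forall>\<^sub>F r in at_top. r \<notin> E \<longrightarrow> \<phi> (r + K) \<le> (1 + \<eta> r) * \<phi> (r - K)"
    and \<theta>: "\<theta> > 0"
  shows "\<forall>\<^sub>F r in at_top. r \<notin> E \<longrightarrow> \<phi> r + a > 0 \<and> \<bar>(B r + b) / (\<phi> r + a) - 1\<bar> \<le> \<theta>"
proof -
  \<comment> \<open>Of the four \<open>d\<close> that fit into \<open>\<theta>\<close>, three pay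
    for \<open>(1 + d)^2\<close> and the fourth for the additive constants.\<close>
  define d where "d = min 1 \<theta> / 4"
  have d: "d > 0" "d \<le> 1" "4 * d \<le> \<theta>" using \<theta> by (auto simp: d_def)
  have dd: "(1 + d)\<^sup>2 \<le> 1 + 3 * d"
    using mult_left_mono[OF d(2), of d] d(1) by (simp add: power2_eq_square algebra_simps)
  obtain C1 where C1: "\<forall>\<^sub>F r in at_top. B r \<le> (1 + d) * \<phi> (r + K) + C1" using upper[OF d(1)] by blast
  obtain C2 where C2: "\<forall>\<^sub>F r in at_top. \<phi> (r - K) \<le> (1 + d) * B r + C2" using lower[OF d(1)] by blast
  \<comment> \<open>The entries serve, in order, positivity, the upper estimate and the lower
    estimate; the \<open>4\<close> in the last comes from \<open>1 + 3 * d <= 4\<close>.\<close>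
  define M where "M = Max {\<bar>a\<bar> + 1 + 2 * \<bar>C2\<bar>, (C1 + \<bar>b\<bar> + (1 + \<theta>) * \<bar>a\<bar>) / d,
      4 * (2 * \<bar>C2\<bar> + \<bar>a\<bar> + (1 + \<theta>) * \<bar>b\<bar>) / d + 2 * \<bar>C2\<bar>}"
  have M: "M \<ge> \<bar>a\<bar> + 1 + 2 * \<bar>C2\<bar>" "M \<ge> (C1 + \<bar>b\<bar> + (1 + \<theta>) * \<bar>a\<bar>) / d"
      "M \<ge> 4 * (2 * \<bar>C2\<bar> + \<bar>a\<bar> + (1 + \<theta>) * \<bar>b\<bar>) / d + 2 * \<bar>C2\<bar>"
    unfolding M_def by (intro Max_ge; simp)+
  have "filterlim (\<lambda>r. r - K) at_top at_top" by real_asymp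
  from filterlim_compose[OF top this] have "filterlim (\<lambda>r. \<phi> (r - K)) at_top at_top" .
  hence "\<forall>\<^sub>F r in at_top. \<phi> (r - K) \<ge> 0" by (simp add: filterlim_at_top)
  moreover have "\<forall>\<^sub>F r in at_top. \<phi> r \<ge> M" using top by (simp add: filterlim_at_top)
  moreover have "\<forall>\<^sub>F r in at_top. \<eta> r < d" using \<eta> d by (intro order_tendstoD)
  ultimately show ?thesis using mono growth C1 C2
  proof eventually_elim
    case (elim r)
    show ?case
    proof
      assume "r \<notin> E"
      hence g: "\<phi> (r + K) \<le> (1 + \<eta> r) * \<phi> (r - K)" using elim by blast
      also have "\<dots> \<le> (1 + d) * \<phi> (r - K)" using elim by (intro mult_right_mono) auto
      finally have pm: "\<phi> (r + K) \<le> (1 + d) * \<phi> (r - K)" .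
      have phi1: "\<phi> r \<ge> \<bar>a\<bar> + 1 + 2 * \<bar>C2\<bar>"
        by (rule order_trans[OF M(1) elim(2)])
      have "\<phi> r \<ge> (C1 + \<bar>b\<bar> + (1 + \<theta>) * \<bar>a\<bar>) / d"
        by (rule order_trans[OF M(2) elim(2)])
      hence phi2: "d * \<phi> r \<ge> C1 + \<bar>b\<bar> + (1 + \<theta>) * \<bar>a\<bar>"
        using d(1) by (simp only: pos_divide_le_eq mult.commute[of d])
      have "\<phi> r \<ge> 4 * (2 * \<bar>C2\<bar> + \<bar>a\<bar> + (1 + \<theta>) * \<bar>b\<bar>) / d + 2 * \<bar>C2\<bar>"
        by (rule order_trans[OF M(3) elim(2)])
      hence "4 * (2 * \<bar>C2\<bar> + \<bar>a\<bar> + (1 + \<theta>) * \<bar>b\<bar>) / d \<le> \<phi> r - 2 * \<bar>C2\<bar>"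
        by (simp only: le_diff_eq)
      hence phi3: "d * (\<phi> r - 2 * \<bar>C2\<bar>) \<ge> 4 * (2 * \<bar>C2\<bar> + \<bar>a\<bar> + (1 + \<theta>) * \<bar>b\<bar>)"
        using d(1) by (simp only: pos_divide_le_eq mult.commute[of d])
      have phi_pos: "\<phi> r > 0" "\<phi> r + a > 0" using phi1 by linarith+

      have "B r \<le> (1 + d) * ((1 + d) * \<phi> (r - K)) + C1"
        using elim pm mult_left_mono[OF pm, of "1 + d"] d by linarith
      also have "\<dots> = (1 + d)\<^sup>2 * \<phi> (r - K) + C1" by (simp add: power2_eq_square)
      also have "\<dots> \<le> (1 + 3 * d) * \<phi> r + C1"
        using dd elim d by (intro add_right_mono mult_mono) auto
      finally have Bup: "B r \<le> (1 + 3 * d) * \<phi> r + C1" .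
      have "(4 * d) * \<phi> r \<le> \<theta> * \<phi> r" using d phi_pos by (intro mult_right_mono) auto
      moreover have "(1 + \<theta>) * a \<ge> - ((1 + \<theta>) * \<bar>a\<bar>)"
        using mult_left_mono[of "-\<bar>a\<bar>" a "1 + \<theta>"] \<theta> by simp
      ultimately have X: "B r + b \<le> (1 + \<theta>) * (\<phi> r + a)"
        using Bup phi2 by (simp add: distrib_left distrib_right)

      have "\<phi> r \<le> (1 + d) * ((1 + d) * B r + C2)"
        using elim pm mult_left_mono[of "\<phi> (r - K)" "(1 + d) * B r + C2" "1 + d"] d by linarith
      also have "\<dots> = (1 + d)\<^sup>2 * B r + (1 + d) * C2" by (simp add: power2_eq_square algebra_simps)
      also have "(1 + d) * C2 \<le> (1 + d) * \<bar>C2\<bar>" using d by (intro mult_left_mono) auto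
      also have "\<dots> \<le> 2 * \<bar>C2\<bar>" using d by (intro mult_right_mono) auto
      finally have Blo': "\<phi> r - 2 * \<bar>C2\<bar> \<le> (1 + d)\<^sup>2 * B r" by simp
      \<comment> \<open>\<open>B r\<close> has to be known positive before its factor
        \<open>(1 + d)^2\<close> may be enlarged to \<open>1 + 3 * d\<close>.\<close>
      hence "(1 + d)\<^sup>2 * B r > 0" using phi1 by linarith
      hence Bpos: "B r > 0" using d by (simp add: zero_less_mult_iff)
      have "(1 + d)\<^sup>2 * B r \<le> (1 + 3 * d) * B r" using dd Bpos by (intro mult_right_mono) auto
      hence Blo: "\<phi> r - 2 * \<bar>C2\<bar> \<le> (1 + 3 * d) * B r" using Blo' by linarith
      also have "\<dots> \<le> 4 * B r" using d Bpos by (intro mult_right_mono) auto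
      finally have "d * (\<phi> r - 2 * \<bar>C2\<bar>) \<le> d * (4 * B r)" using d by (intro mult_left_mono) auto
      hence dB: "d * B r \<ge> 2 * \<bar>C2\<bar> + \<bar>a\<bar> + (1 + \<theta>) * \<bar>b\<bar>" using phi3 by simp
      have "(4 * d) * B r \<le> \<theta> * B r" using d Bpos by (intro mult_right_mono) auto
      moreover have "(1 + \<theta>) * b \<ge> - ((1 + \<theta>) * \<bar>b\<bar>)"
        using mult_left_mono[of "-\<bar>b\<bar>" b "1 + \<theta>"] \<theta> by simp
      ultimately have Y: "\<phi> r + a \<le> (1 + \<theta>) * (B r + b)"
        using Blo dB by (simp add: distrib_left distrib_right)

      have "(B r + b) / (\<phi> r + a) \<le> 1 + \<theta>" using X phi_pos by (simp add: divide_le_eq)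
      moreover have "(B r + b) / (\<phi> r + a) \<ge> 1 - \<theta>"
      proof -
        have "B r + b \<ge> (\<phi> r + a) / (1 + \<theta>)" using Y \<theta> by (simp add: divide_le_eq mult.commute)
        moreover have "(\<phi> r + a) / (1 + \<theta>) \<ge> (\<phi> r + a) * (1 - \<theta>)"
        proof -
          have "(1 - \<theta>) * (1 + \<theta>) \<le> 1" by (simp add: algebra_simps)
          hence "(\<phi> r + a) * ((1 - \<theta>) * (1 + \<theta>)) \<le> (\<phi> r + a) * 1"
            using phi_pos by (intro mult_left_mono) auto
          thus ?thesis using \<theta> by (simp add: le_divide_eq mult.assoc)
        qed
        ultimately have "(1 - \<theta>) * (\<phi> r + a) \<le> B r + b" by (simp only: mult.commute[of "1 - \<theta>"])
        thus ?thesis using phi_pos by (simp add: le_divide_eq)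
      qed
      ultimately show "\<phi> r + a > 0 \<and> \<bar>(B r + b) / (\<phi> r + a) - 1\<bar> \<le> \<theta>"
        using phi_pos by (simp add: abs_le_iff)
    qed
  qed
qed

section \<open>Growth of the mean of \<open>U\<close>\<close>

context entire_quotient
begin

lemma cmean_U_tendsto_at_top:
  assumes nonconst: "\<nexists>a. \<forall>z. G z = a * H z"
  shows "filterlim (cmean U) at_top at_top"
proof -
  obtain C r0 where C: "\<And>r. r > r0 \<Longrightarrow> cmean U r \<ge> ln (r - r0) - C"
    using cmean_U_lower_bound[OF nonconst] by blast
  have "filterlim (\<lambda>r. ln (r - r0) - C) at_top at_top" by real_asymp
  thus ?thesis
    by (rule filterlim_at_top_mono) (rule eventually_mono[OF eventually_gt_at_top[of r0]], rule C)
qed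

text \<open>The characteristic is identified only off \<open>N\<close>, so the bound is taken at a
  nearby \<open>y\<close> and carried to \<open>x\<close> by monotonicity. The \<open>3\<close> is
  made up of \<open>ln 2 <= 1\<close>, from bounding the mean by \<open>2 * nev_T y F\<close>, and
  \<open>2 powr s <= 2\<close>, from \<open>y <= 2 * x\<close>.\<close>

lemma cmean_U_growth:
  assumes nonconst: "\<nexists>a. \<forall>z. G z = a * H z" and s: "0 < s" "s \<le> 1"
    and ev: "\<forall>\<^sub>F r in at_top. ln (ln (nev_T r F)) / ln r < s"
  shows "\<exists>x0. \<forall>x\<ge>x0. cmean U x \<ge> 1 \<and> ln (cmean U x) \<le> 3 * x powr s"
proof -
  obtain C N where CN: "countable N" "\<And>r. r > 0 \<Longrightarrow> r \<notin> N \<Longrightarrow> nev_T r F = cmean U r + C"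
    using nev_T_eq_cmean by blast
  \<comment> \<open>The threshold makes \<open>\<bar>C\<bar>\<close> at most half of the mean and
    the characteristic at least \<open>exp 1\<close>, so that its logarithm is positive and the
    iterated logarithm can be inverted.\<close>
  have "\<forall>\<^sub>F r in at_top. cmean U r \<ge> 2 * \<bar>C\<bar> + 2 * exp 1"
    using cmean_U_tendsto_at_top[OF nonconst] by (simp add: filterlim_at_top)
  hence "\<forall>\<^sub>F r in at_top. r \<ge> 2 \<and> cmean U r \<ge> 2 * \<bar>C\<bar> + 2 * exp 1 \<and> ln (ln (nev_T r F)) / ln r < s"
    using ev eventually_ge_at_top[of "2::real"] by eventually_elim auto
  then obtain x0 where x0: "\<And>r. r \<ge> x0 \<Longrightarrow> r \<ge> 2 \<and> cmean U r \<ge> 2 * \<bar>C\<bar> + 2 * exp 1 \<and> ln (ln (nev_T r F)) / ln r < s"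
    by (auto simp: eventually_at_top_linorder)
  have "cmean U x \<ge> 1 \<and> ln (cmean U x) \<le> 3 * x powr s" if x: "x \<ge> x0" for x
  proof -
    have "uncountable ({x..x+1} - N)"
      using CN(1) by (simp add: uncountable_closed_interval uncountable_minus_countable)
    hence "{x..x+1} - N \<noteq> {}" by (metis countable_empty)
    then obtain y where "y \<in> {x..x+1} - N" by blast
    hence y: "x \<le> y" "y \<le> x + 1" "y \<notin> N" by auto
    have x2: "x \<ge> 2" and Ax: "cmean U x \<ge> 2 * exp 1" using x0[OF x] by auto
    have y2: "y \<ge> 2" and Ay: "cmean U y \<ge> 2 * \<bar>C\<bar> + 2 * exp 1" and T: "ln (ln (nev_T y F)) / ln y < s"
      using x0[of y] x y by auto
    have Ty: "nev_T y F = cmean U y + C" using CN(2)[of y] y y2 by simp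
    hence Te: "nev_T y F \<ge> exp 1" and TA: "cmean U y \<le> 2 * nev_T y F" using Ay exp_gt_zero[of "1::real"] by linarith+
    have lnT: "ln (nev_T y F) \<ge> 1" using ln_mono[OF Te exp_gt_zero] by simp
    have "ln (ln (nev_T y F)) < s * ln y" using T y2 by (simp add: divide_less_eq)
    hence "exp (ln (ln (nev_T y F))) < exp (s * ln y)" by simp
    moreover have "exp (ln (ln (nev_T y F))) = ln (nev_T y F)" using lnT by (intro exp_ln) linarith
    ultimately have lnT': "ln (nev_T y F) \<le> y powr s" using y2 by (simp add: powr_def)
    have "cmean U x \<le> cmean U y" using x2 y by (intro cmean_mono_radius poisson_sub_U) auto
    hence "ln (cmean U x) \<le> ln (2 * nev_T y F)"
      using Ax TA exp_gt_zero[of "1::real"] by (intro ln_mono) linarith+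
    also have "\<dots> = ln 2 + ln (nev_T y F)" 
    proof -
      have "nev_T y F > 0" using Te exp_gt_zero[of "1::real"] by linarith
      thus ?thesis by (simp add: ln_mult)
    qed
    also have "\<dots> \<le> 1 + (2 * x) powr s"
    proof (rule add_mono)
      show "ln 2 \<le> (1::real)" using ln_le_minus_one[of "2::real"] by simp
      show "ln (nev_T y F) \<le> (2 * x) powr s"
        using lnT' powr_mono2[of s y "2 * x"] y y2 x2 s by linarith
    qed
    also have "(2 * x) powr s = 2 powr s * x powr s" using x2 by (simp add: powr_mult)
    also have "\<dots> \<le> 2 * x powr s" using powr_mono[of s 1 "2::real"] s by (intro mult_right_mono) auto
    also have "1 \<le> x powr s" using x2 s by (intro ge_one_powr_ge_zero) auto
    finally have "ln (cmean U x) \<le> 3 * x powr s" by simp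
    moreover have "exp 1 \<ge> (1::real)" by simp
    ultimately show ?thesis using Ax by linarith
  qed
  thus ?thesis by blast
qed

text \<open>Without common zeros, \<open>G = a * H\<close> forces \<open>H\<close> to be zero-free,
  so \<open>F\<close> is the constant \<open>a\<close> everywhere.\<close>

lemma nev_T_constant:
  assumes "\<And>z. G z = a * H z"
  shows "nev_T r (F \<circ> w) = nev_T s F"
proof -
  have H0: "H z \<noteq> 0" for z using no_common[of z] assms[of z] by auto
  have F: "F = (\<lambda>_. a)" by (rule ext) (use F_eq H0 assms in simp)
  have np: "\<not> is_pole_pt (\<lambda>_. a) p" for p using not_pole[OF H0] F by simp
  show ?thesis
    unfolding F o_def nev_T_def proximity_def integrated_count_def pole_count_def by (simp_all add: np)
qed

end

section \<open>Size of a polynomial on large circles\<close>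

text \<open>The lower terms shift the radius by at most a constant, because
  \<open>y^n + P * y^(n-1) = y^(n-1) * (y + P)\<close> and likewise with minus. The
  \<open>1/2\<close> and \<open>S\<close> provide the room that holomorphy beyond a closed disc
  demands.\<close>

lemma poly_geometry:
  fixes Q :: "complex poly"
  assumes deg: "degree Q = n" "n \<ge> 1"
  defines "c \<equiv> lead_coeff Q"
  shows "\<exists>K>0. \<forall>r>K + 1. (\<forall>x\<in>ball 0 (r + 1/2). norm (poly Q x) < norm c * (r + K) ^ n)
      \<and> (\<exists>S>norm c * (r - K) ^ n. \<forall>x. norm x \<ge> r \<longrightarrow> norm (poly Q x) \<ge> S)"
proof -
  have "Q \<noteq> 0" using deg by auto
  hence c: "norm c > 0" by (simp add: c_def)
  define P where "P = (\<Sum>k<n. norm (coeff Q k)) / norm c"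
  have step: "C * (y ^ (n - 1) * y) + C * P * y ^ (n - 1) = C * (y ^ (n - 1) * (y + P))"
    "C * (y ^ (n - 1) * y) - C * P * y ^ (n - 1) = C * (y ^ (n - 1) * (y - P))" for C y :: real
    by (simp_all add: algebra_simps)
  have P: "P \<ge> 0" using c by (simp add: P_def sum_nonneg)
  have Qx: "poly Q x = c * x ^ n + (\<Sum>k<n. coeff Q k * x ^ k)" for x
  proof -
    have "poly Q x = (\<Sum>k\<in>insert n {..<n}. coeff Q k * x ^ k)"
      unfolding poly_altdef deg(1) by (rule sum.cong) auto
    thus ?thesis by (simp add: c_def deg)
  qed
  have rest: "norm (\<Sum>k<n. coeff Q k * x ^ k) \<le> norm c * P * \<rho> ^ (n - 1)" if "norm x \<le> \<rho>" "\<rho> \<ge> 1" for x \<rho>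
  proof -
    have "norm (\<Sum>k<n. coeff Q k * x ^ k) \<le> (\<Sum>k<n. norm (coeff Q k) * \<rho> ^ (n - 1))"
    proof (rule sum_norm_le)
      fix k assume "k \<in> {..<n}"
      hence "norm x ^ k \<le> \<rho> ^ k" "\<rho> ^ k \<le> \<rho> ^ (n - 1)"
        using that by (auto intro!: power_mono power_increasing)
      thus "norm (coeff Q k * x ^ k) \<le> norm (coeff Q k) * \<rho> ^ (n - 1)"
        unfolding norm_mult norm_power by (intro mult_left_mono) auto
    qed
    also have "\<dots> = norm c * P * \<rho> ^ (n - 1)" using c by (simp add: P_def sum_distrib_right)
    finally show ?thesis .
  qed
  have pow: "y ^ n = y ^ (n - 1) * y" for y :: real using deg by (cases n) auto
  \<comment> \<open>In \<open>K = P + 1\<close> the \<open>1\<close> covers the \<open>1/2\<close>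
    and makes both inequalities strict.\<close>
  show ?thesis
  proof (rule exI[of _ "P + 1"], intro conjI allI impI ballI)
    fix r x assume r: "r > P + 1 + 1" and x: "x \<in> ball (0::complex) (r + 1/2)"
    let ?\<rho> = "r + 1/2"
    have "norm (poly Q x) \<le> norm c * norm x ^ n + norm c * P * ?\<rho> ^ (n - 1)"
      unfolding Qx using rest[of x ?\<rho>] x r P by (intro norm_triangle_le add_mono) (auto simp: norm_mult norm_power)
    also have "\<dots> \<le> norm c * ?\<rho> ^ n + norm c * P * ?\<rho> ^ (n - 1)"
      using x by (intro add_right_mono mult_left_mono power_mono) auto
    also have "\<dots> = norm c * (?\<rho> ^ (n - 1) * (?\<rho> + P))" unfolding pow by (rule step)
    also have "\<dots> < norm c * ((r + (P + 1)) ^ (n - 1) * (r + (P + 1)))"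
    proof (rule mult_strict_left_mono[OF _ c])
      have "?\<rho> ^ (n - 1) \<le> (r + (P + 1)) ^ (n - 1)" using r P by (intro power_mono) auto
      thus "?\<rho> ^ (n - 1) * (?\<rho> + P) < (r + (P + 1)) ^ (n - 1) * (r + (P + 1))"
        using r P by (intro mult_le_less_imp_less) auto
    qed
    finally show "norm (poly Q x) < norm c * (r + (P + 1)) ^ n" unfolding pow .
  next
    fix r assume r: "r > P + 1 + 1"
    show "\<exists>S>norm c * (r - (P + 1)) ^ n. \<forall>x. norm x \<ge> r \<longrightarrow> norm (poly Q x) \<ge> S"
    proof (rule exI[of _ "norm c * (r ^ (n - 1) * (r - P))"], intro conjI allI impI)
      show "norm c * (r - (P + 1)) ^ n < norm c * (r ^ (n - 1) * (r - P))"
        unfolding pow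
      proof (rule mult_strict_left_mono[OF _ c])
        have "(r - (P + 1)) ^ (n - 1) \<le> r ^ (n - 1)" using r P by (intro power_mono) auto
        thus "(r - (P + 1)) ^ (n - 1) * (r - (P + 1)) < r ^ (n - 1) * (r - P)"
          using r P by (intro mult_le_less_imp_less) auto
      qed
      fix x :: complex assume x: "norm x \<ge> r"
      \<comment> \<open>\<open>y^(n-1) * (y - P)\<close> increases for \<open>y >= P\<close>, so the
        bound at radius \<open>r\<close> persists outside.\<close>
      have "norm c * (r ^ (n - 1) * (r - P)) \<le> norm c * (norm x ^ (n - 1) * (norm x - P))"
        using x r P by (intro mult_left_mono mult_mono power_mono) auto
      also have "\<dots> = norm (c * x ^ n) - norm c * P * norm x ^ (n - 1)"
        unfolding norm_mult norm_power pow by (rule step(2)[symmetric])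
      also have "\<dots> \<le> norm (c * x ^ n) - norm (\<Sum>k<n. coeff Q k * x ^ k)"
        using rest[of x "norm x"] x r P by simp
      also have "\<dots> \<le> norm (poly Q x)" unfolding Qx by (rule norm_diff_ineq)
      finally show "norm (poly Q x) \<ge> norm c * (r ^ (n - 1) * (r - P))" .
    qed
  qed (use P in auto)
qed

lemma poly_of_coeffs:
  fixes c :: complex and p :: "nat \<Rightarrow> complex"
  assumes "c \<noteq> 0"
  shows "\<exists>Q. degree Q = n \<and> lead_coeff Q = c \<and> (\<forall>z. poly Q z = c * z ^ n + (\<Sum>k<n. p k * z ^ k))"
proof -
  define Q where "Q = monom c n + (\<Sum>k<n. monom (p k) k)"
  have "coeff Q k = (if k = n then c else if k < n then p k else 0)" for k
    by (simp add: Q_def coeff_sum sum.delta')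
  hence Qn: "coeff Q n = c" and "\<And>k. k > n \<Longrightarrow> coeff Q k = 0" by auto
  hence "degree Q \<le> n" by (intro degree_le) blast
  moreover have "n \<le> degree Q" using Qn assms by (intro le_degree) simp
  ultimately have "degree Q = n" by simp
  moreover have "poly Q z = c * z ^ n + (\<Sum>k<n. p k * z ^ k)" for z
    by (simp add: Q_def poly_monom poly_sum)
  ultimately show ?thesis using Qn by blast
qed

lemma surj_poly:
  fixes Q :: "complex poly"
  assumes "degree Q > 0"
  shows "range (poly Q) = UNIV"
proof -
  have "\<exists>z. poly Q z = w" for w
  proof -
    have "\<not> constant (poly (Q - [:w:]))"
      unfolding constant_degree degree_diff_const[OF assms] using assms by simp
    from fundamental_theorem_of_algebra[OF this] show ?thesis by simp
  qed
  thus ?thesis by (metis UNIV_eq_I rangeI)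
qed

lemma countable_vimage_circle_radius:
  assumes "countable N" "c > 0" "n \<ge> 1"
  shows "countable {r::real. r \<ge> 1 \<and> c * r ^ n \<in> N}"
proof (rule countable_image_inj_on)
  show "countable ((\<lambda>r. c * r ^ n) ` {r. r \<ge> 1 \<and> c * r ^ n \<in> N})"
    by (rule countable_subset[OF _ assms(1)]) auto
  show "inj_on (\<lambda>r. c * r ^ n) {r. r \<ge> 1 \<and> c * r ^ n \<in> N}"
  proof (rule inj_onI)
    fix x y assume xy: "x \<in> {r. r \<ge> 1 \<and> c * r ^ n \<in> N}" "y \<in> {r. r \<ge> 1 \<and> c * r ^ n \<in> N}"
      and "c * x ^ n = c * y ^ n"
    hence "x ^ n = y ^ n" using assms(2) by simp
    thus "x = y" by (rule power_eq_imp_eq_base) (use xy assms(3) in auto)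
  qed
qed

theorem theorem6:
  fixes n :: nat and c :: complex and p :: "nat \<Rightarrow> complex" and f :: "complex \<Rightarrow> complex"
  assumes "n \<ge> 1" and "c \<noteq> 0"
    and "meromorphic_C f"
    and "Limsup at_top (\<lambda>r. ereal (ln (ln (nev_T r f)) / ln r)) < ereal (1 / real n ^ 2)"
  shows "\<exists>E \<epsilon>. finite_log_measure E \<and> (\<epsilon> \<longlongrightarrow> 0) at_top \<and>
    (\<forall>\<^sub>F r in at_top. r \<notin> E \<longrightarrow>
       nev_T r (f \<circ> (\<lambda>z. c * z ^ n + (\<Sum>k<n. p k * z ^ k)))
         = (1 + \<epsilon> r) * nev_T (cmod c * r ^ n) f)"
proof -
  obtain G H where "entire_quotient G H f" using meromorphic_C_quotient[OF assms(3)] by blast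
  then interpret f: entire_quotient G H f .
  obtain Q where Q: "degree Q = n" "lead_coeff Q = c" and
      Qz: "\<And>z. poly Q z = c * z ^ n + (\<Sum>k<n. p k * z ^ k)"
    using poly_of_coeffs[OF assms(2)] by blast
  have Q_eq: "(\<lambda>z. c * z ^ n + (\<Sum>k<n. p k * z ^ k)) = poly Q" using Qz by auto
  have deg: "degree Q > 0" using Q assms(1) by simp
  have c: "cmod c > 0" using assms(2) by simp
  have hQ: "poly Q holomorphic_on A" for A by (intro holomorphic_intros)
  show ?thesis unfolding Q_eq
  proof (cases "\<exists>a. \<forall>z. G z = a * H z")
    \<comment> \<open>Here \<open>f\<close> is constant and the error is zero; divergence of the
      mean of \<open>U\<close>, on which the comparison rests, is available in the other
      case.\<close>
    case True
    then obtain a where "\<And>z. G z = a * H z" by blast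
    note eq = f.nev_T_constant[OF this]
    have "nev_T r (f \<circ> poly Q) = (1 + 0) * nev_T (cmod c * r ^ n) f" for r
      using eq[of r "poly Q" "cmod c * r ^ n"] by simp
    thus "\<exists>E \<epsilon>. finite_log_measure E \<and> (\<epsilon> \<longlongrightarrow> 0) at_top \<and>
        (\<forall>\<^sub>F r in at_top. r \<notin> E \<longrightarrow> nev_T r (f \<circ> poly Q) = (1 + \<epsilon> r) * nev_T (cmod c * r ^ n) f)"
      by (intro exI[of _ "{}"] exI[of _ "\<lambda>_. 0"]) (auto simp: finite_log_measure_def)
  next
    case nonconst: False
    interpret fQ: entire_quotient "G \<circ> poly Q" "H \<circ> poly Q" "f \<circ> poly Q"
      by (rule f.compose[OF hQ surj_poly[OF deg]])
    have UQ: "fQ.U = (\<lambda>x. f.U (poly Q x))" by (auto simp: f.U_def fQ.U_def)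
    define A where "A = cmean f.U"
    define B where "B = cmean fQ.U"
    define \<phi> where "\<phi> r = A (cmod c * r ^ n)" for r

    obtain a N1 where N1: "countable N1" "\<And>r. r > 0 \<Longrightarrow> r \<notin> N1 \<Longrightarrow> nev_T r f = A r + a"
      using f.nev_T_eq_cmean unfolding A_def by blast
    obtain b N2 where N2: "countable N2" "\<And>r. r > 0 \<Longrightarrow> r \<notin> N2 \<Longrightarrow> nev_T r (f \<circ> poly Q) = B r + b"
      using fQ.nev_T_eq_cmean unfolding B_def by blast

    obtain t where t: "Limsup at_top (\<lambda>r. ereal (ln (ln (nev_T r f)) / ln r)) < ereal t" "t < 1 / real n ^ 2"
      using ereal_dense2[OF assms(4)] by auto
    \<comment> \<open>\<open>t\<close> may be nonpositive, but the growth estimates ask for a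
      positive exponent.\<close>
    define s where "s = max t (1 / (2 * real n ^ 2))"
    have s: "0 < s" "s < 1 / real n ^ 2" "t \<le> s"
    proof -
      have "0 < 1 / (2 * real n ^ 2)" "1 / (2 * real n ^ 2) < 1 / real n ^ 2"
        using assms(1) by (auto simp: field_simps)
      thus "0 < s" "s < 1 / real n ^ 2" "t \<le> s" using t(2) by (auto simp: s_def)
    qed
    have n2: "real n * real n \<ge> 1" using assms(1) using mult_mono[of 1 "real n" 1 "real n"] by simp
    \<comment> \<open>As a function of \<open>r\<close>, \<open>\<phi>\<close> has growth exponent
      \<open>n * s\<close>, which has to be below one for the Borel-type argument.\<close>
    have s1: "s \<le> 1" "real n * s < 1"
    proof -
      have "s * (real n * real n) < 1" using s(2) assms(1) by (simp add: field_simps power2_eq_square)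
      moreover have "s * 1 \<le> s * (real n * real n)" using n2 s(1) by (intro mult_left_mono) auto
      moreover have "s * real n \<le> s * (real n * real n)" using assms(1) s(1) by (intro mult_left_mono) auto
      ultimately show "s \<le> 1" "real n * s < 1" by (auto simp: mult.commute)
    qed
    have ev: "\<forall>\<^sub>F r in at_top. ln (ln (nev_T r f)) / ln r < s"
      using Limsup_lessD[OF t(1)] s(3) by (auto elim!: eventually_mono)
    obtain x0 where x0: "\<And>x. x \<ge> x0 \<Longrightarrow> A x \<ge> 1" "\<And>x. x \<ge> x0 \<Longrightarrow> ln (A x) \<le> 3 * x powr s"
      using f.cmean_U_growth[OF nonconst s(1) s1(1) ev] unfolding A_def by blast
    have A_top: "filterlim A at_top at_top"
      unfolding A_def by (rule f.cmean_U_tendsto_at_top[OF nonconst])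
    have A_mono: "A x \<le> A y" if "0 < x" "x \<le> y" for x y
      unfolding A_def using that by (intro cmean_mono_radius f.poisson_sub_U)

    obtain K where K: "K > 0" and
      geo1: "\<And>r x. r > K + 1 \<Longrightarrow> x \<in> ball 0 (r + 1/2) \<Longrightarrow> norm (poly Q x) < cmod c * (r + K) ^ n" and
      geo2: "\<And>r. r > K + 1 \<Longrightarrow> \<exists>S>cmod c * (r - K) ^ n. \<forall>x. norm x \<ge> r \<longrightarrow> norm (poly Q x) \<ge> S"
      using poly_geometry[OF Q(1) assms(1)] unfolding Q(2) by blast
    have pow_top: "filterlim (\<lambda>r. cmod c * (r + k) ^ n) at_top at_top" for k
      using c assms(1) by (intro filterlim_tendsto_pos_mult_at_top[OF tendsto_const c] filterlim_pow_at_top)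
        (auto, real_asymp)
    have pow_mono: "cmod c * r ^ n \<le> cmod c * r' ^ n" if "0 \<le> r" "r \<le> r'" for r r'
      using that by (intro mult_left_mono power_mono) auto
    have \<phi>_top: "filterlim \<phi> at_top at_top"
      unfolding \<phi>_def using filterlim_compose[OF A_top pow_top[of 0]] by simp
    have \<phi>_mono: "\<phi> r \<le> \<phi> r'" if "0 < r" "r \<le> r'" for r r'
      unfolding \<phi>_def using that c by (intro A_mono pow_mono) auto

    \<comment> \<open>\<open>Q\<close> maps the ball of radius \<open>r + 1/2\<close> into the disc
      of radius \<open>cmod c * (r + K) ^ n\<close>, and Harnack's inequality is used at the fixed
      point \<open>poly Q 0\<close>.\<close>
    have upper: "\<exists>C. \<forall>\<^sub>F r in at_top. B r \<le> (1 + d) * \<phi> (r + K) + C" if d: "d > 0" for d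
    proof -
      obtain C R0 where C: "\<And>R. R > R0 \<Longrightarrow> poisson R f.U (poly Q 0) \<le> (1 + d) * A R + C"
        using poisson_le_cmean_asymp[OF f.poisson_sub_U d] unfolding A_def by blast
      have "\<forall>\<^sub>F r in at_top. cmod c * (r + K) ^ n > R0"
        using pow_top[of K] by (simp add: filterlim_at_top_dense)
      hence "\<forall>\<^sub>F r in at_top. B r \<le> (1 + d) * \<phi> (r + K) + C"
        using eventually_gt_at_top[of "K + 1"]
      proof eventually_elim
        case (elim r)
        have "B r \<le> poisson (cmod c * (r + K) ^ n) f.U (poly Q 0)"
          unfolding B_def UQ
          by (rule cmean_compose_le_poisson[OF f.poisson_sub_U hQ[of "ball 0 (r + 1/2)"]])
             (use elim K geo1[of r] in auto)
        also have "\<dots> \<le> (1 + d) * \<phi> (r + K) + C" unfolding \<phi>_def by (rule C) (use elim in auto)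
        finally show ?case .
      qed
      thus ?thesis by blast
    qed

    \<comment> \<open>The circle of radius \<open>cmod c * (r - K) ^ n\<close> has all its preimages
      inside radius \<open>r\<close>; Harnack's inequality is used at the \<open>n\<close> zeros of
      \<open>Q\<close>, and the sum is divided by \<open>n\<close>.\<close>
    have lower: "\<exists>C. \<forall>\<^sub>F r in at_top. \<phi> (r - K) \<le> (1 + d) * B r + C" if d: "d > 0" for d
    proof -
      obtain C R0 where C: "\<And>R. R > R0 \<Longrightarrow> (\<Sum>z\<in>#proots Q. poisson R fQ.U z)
          \<le> real (size (proots Q)) * ((1 + d) * B R) + C"
        using poisson_sum_mset_le_cmean[OF fQ.poisson_sub_U d] unfolding B_def by blast
      have size: "size (proots Q) = n" using size_proots_complex Q(1) by simp
      have "\<forall>\<^sub>F r in at_top. \<phi> (r - K) \<le> (1 + d) * B r + C / real n"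
        using eventually_gt_at_top[of "max R0 (K + 1)"]
      proof eventually_elim
        case (elim r)
        obtain S where S: "S > cmod c * (r - K) ^ n" "\<And>x. norm x \<ge> r \<Longrightarrow> norm (poly Q x) \<ge> S"
          using geo2[of r] elim by auto
        have "real (degree Q) * \<phi> (r - K) \<le> (\<Sum>z\<in>#proots Q. poisson r (\<lambda>x. f.U (poly Q x)) z)"
          unfolding \<phi>_def A_def
          by (rule cmean_le_sum_poisson[OF _ f.poisson_sub_U deg _ S(1)])
             (use fQ.poisson_sub_U c elim K S in \<open>auto simp: UQ\<close>)
        also have "\<dots> \<le> real n * ((1 + d) * B r) + C" using C[of r] elim size unfolding UQ by auto
        finally have "\<phi> (r - K) \<le> (real n * ((1 + d) * B r) + C) / real n"
          using Q(1) assms(1) by (simp add: le_divide_eq mult.commute)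
        also have "\<dots> = (1 + d) * B r + C / real n" using assms(1) by (simp add: add_divide_distrib)
        finally show ?case .
      qed
      thus ?thesis by blast
    qed

    obtain r0 where r0: "r0 \<ge> 1" "\<And>r. r \<ge> r0 \<Longrightarrow> cmod c * r ^ n \<ge> x0"
    proof -
      have "\<forall>\<^sub>F r in at_top. cmod c * r ^ n \<ge> x0"
        using pow_top[of 0] by (simp add: filterlim_at_top)
      then obtain r1 where "\<And>r. r \<ge> r1 \<Longrightarrow> cmod c * r ^ n \<ge> x0"
        by (auto simp: eventually_at_top_linorder)
      thus ?thesis by (intro that[of "max r1 1"]) auto
    qed
    have "\<exists>E \<eta>. finite_log_measure E \<and> (\<eta> \<longlongrightarrow> 0) at_top \<and>
        (\<forall>\<^sub>F r in at_top. r \<notin> E \<longrightarrow> \<phi> (r + K) \<le> (1 + \<eta> r) * \<phi> (r - K))"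
    proof (rule growth_regular_off_finite_log_measure[where ?r0.0 = r0 and s = "real n * s" and C = "3 * cmod c powr s"])
      fix r assume r: "r0 \<le> r"
      show "\<phi> r \<ge> 1" unfolding \<phi>_def by (intro x0 r0 r)
      have "ln (\<phi> r) \<le> 3 * (cmod c * r ^ n) powr s" unfolding \<phi>_def by (intro x0 r0 r)
      also have "(cmod c * r ^ n) powr s = cmod c powr s * r powr (real n * s)"
        using r r0(1) c by (simp add: powr_mult powr_powr flip: powr_realpow)
      finally show "ln (\<phi> r) \<le> 3 * cmod c powr s * r powr (real n * s)" by simp
    qed (use r0 \<phi>_mono s(1) s1 assms(1) K in auto)
    then obtain E \<eta> where E: "finite_log_measure E" "(\<eta> \<longlongrightarrow> 0) at_top"
        "\<forall>\<^sub>F r in at_top. r \<notin> E \<longrightarrow> \<phi> (r + K) \<le> (1 + \<eta> r) * \<phi> (r - K)" by blast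
    have mono: "\<forall>\<^sub>F r in at_top. \<phi> (r - K) \<le> \<phi> r \<and> \<phi> r \<le> \<phi> (r + K)"
      using eventually_gt_at_top[of K] by eventually_elim (use \<phi>_mono K in auto)
    note ratio = eventually_ratio_near_1[OF \<phi>_top mono upper lower E(2,3), of _ a b]

    define E' where "E' = E \<union> ({r. r \<ge> 1 \<and> r \<in> N2} \<union> {r. r \<ge> 1 \<and> cmod c * r ^ n \<in> N1})"
    \<comment> \<open>Set to zero on \<open>E'\<close>, so that \<open>\<epsilon>\<close> tends to
      zero along all radii.\<close>
    define \<epsilon> where "\<epsilon> r = (if r \<in> E' then 0 else (B r + b) / (\<phi> r + a) - 1)" for r
    have "finite_log_measure E'"
      unfolding E'_def
    proof (rule finite_log_measure_Un_countable[OF E(1)])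
      have "countable {r. r \<ge> 1 \<and> r \<in> N2}" by (rule countable_subset[OF _ N2(1)]) auto
      thus "countable ({r. r \<ge> 1 \<and> r \<in> N2} \<union> {r. r \<ge> 1 \<and> cmod c * r ^ n \<in> N1})"
        using countable_vimage_circle_radius[OF N1(1) c assms(1)] by simp
    qed auto
    moreover have "(\<epsilon> \<longlongrightarrow> 0) at_top"
    proof (rule tendstoI)
      fix e :: real assume e: "e > 0"
      have "\<forall>\<^sub>F r in at_top. r \<notin> E \<longrightarrow> \<phi> r + a > 0 \<and> \<bar>(B r + b) / (\<phi> r + a) - 1\<bar> \<le> e / 2"
        by (rule ratio) (use e in auto)
      thus "\<forall>\<^sub>F r in at_top. dist (\<epsilon> r) 0 < e"
        by eventually_elim (use e in \<open>auto simp: \<epsilon>_def E'_def\<close>)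
    qed
    moreover have "\<forall>\<^sub>F r in at_top. r \<notin> E \<longrightarrow> \<phi> r + a > 0 \<and> \<bar>(B r + b) / (\<phi> r + a) - 1\<bar> \<le> 1"
      by (rule ratio) auto
    hence "\<forall>\<^sub>F r in at_top. r \<notin> E' \<longrightarrow> nev_T r (f \<circ> poly Q) = (1 + \<epsilon> r) * nev_T (cmod c * r ^ n) f"
      using eventually_ge_at_top[of 1]
    proof eventually_elim
      case (elim r)
      show ?case
      proof
        assume r: "r \<notin> E'"
        hence "nev_T r (f \<circ> poly Q) = B r + b" "nev_T (cmod c * r ^ n) f = \<phi> r + a"
          using elim(2) c N1(2) N2(2) by (auto simp: E'_def \<phi>_def)
        moreover have "\<phi> r + a > 0" using elim r by (auto simp: E'_def)
        ultimately show "nev_T r (f \<circ> poly Q) = (1 + \<epsilon> r) * nev_T (cmod c * r ^ n) f"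
          using r by (simp add: \<epsilon>_def)
      qed
    qed
    ultimately show "\<exists>E \<epsilon>. finite_log_measure E \<and> (\<epsilon> \<longlongrightarrow> 0) at_top \<and>
        (\<forall>\<^sub>F r in at_top. r \<notin> E \<longrightarrow> nev_T r (f \<circ> poly Q) = (1 + \<epsilon> r) * nev_T (cmod c * r ^ n) f)"
      by blast
  qed
qed

end
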